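(* Let $N=2^n$, let $\mathcal X$ be a finite set, let $h:\{0,1\}^{n-1}\to\mathcal X$ be an efficiently computable (time polynomial in $n$) sampler, and let $\mathcal D_h$ be the distribution of $h(R)$ for $R$ uniform on $\{0,1\}^{n-1}$. Let $f:\mathcal X\to\{-1,1\}$ be an unknown labeling function and let $\mathcal D_{h,f}$ be the distribution of $(X,f(X))$ with $X\sim\mathcal D_h$. Let $\epsilon\in(0,1)$, $T\ge1$, and fix a constant $\delta\in(0,1)$. Then there is an implementation of the distribution-specific statistical query oracle $\mathrm{DSQ}_h(f,\epsilon)$ (knowing $h$ but not $f$) with the following guarantee: for any analyst issuing a sequence of $T$ adaptively chosen queries $\phi_1,\dots,\phi_T$ with $\phi_t:\mathcal X\times\{-1,1\}\to[-1,1]$, with probability at least $1-\delta$ the implementation answers each query $\phi_t$ with a value $v_t$ satisfying $|v_t-\mathbb E_{(x,y)\sim\mathcal D_{h,f}}[\phi_t(x,y)]|\le\epsilon$, using $$M\in O\left(\epsilon^{-4}\log(T/\epsilon)\right)$$ i.i.d. samples from $\mathcal D_{h,f}$ and running in time polynomial in $\log N,\epsilon^{-1},T$ (with constants depending only on $\delta$).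
   Context: The distribution-specific statistical query oracle $\mathrm{DSQ}_h(f,\epsilon)$, for a known feature distribution $\mathcal D_h$ and unknown $f$, takes as input a query $\phi:\mathcal X\times\{-1,1\}\to[-1,1]$ and returns a value $v$ with $|v-\mathbb E_{(x,y)\sim\mathcal D_{h,f}}[\phi(x,y)]|\le\epsilon$. An implementation is a randomized algorithm that is given $M$ i.i.d. samples from $\mathcal D_{h,f}$ (hidden from the analyst) and answers queries one at a time; the analyst (possibly randomized) chooses $\phi_t$ as a function of the previous queries and answers. The implementation does not depend on $f$ except through the samples. Probability is over the samples and the randomness of both parties. For the running time, queries are assumed to be evaluable at any given point in time polynomial in $\log N$.
   Formalization: The sample bound is proved with max(1, log(T/ε)) in place of log(T/ε): for T=1 and ε near 1 the literal bound would allow no samples, which is impossible for δ<1/2; running time is counted on a real-number RAM. *)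

theory Defs
  imports "HOL-Probability.Probability" "HOL-Library.Monad_Syntax"
begin

section \<open>Distributions and queries\<close>

definition sampler_dist :: "nat \<Rightarrow> (bool list \<Rightarrow> 'x) \<Rightarrow> 'x pmf" where
  "sampler_dist n h = map_pmf h (pmf_of_set {r. length r = n - 1})"

definition labeled_dist :: "nat \<Rightarrow> (bool list \<Rightarrow> 'x) \<Rightarrow> ('x \<Rightarrow> int) \<Rightarrow> ('x \<times> int) pmf" where
  "labeled_dist n h f = map_pmf (\<lambda>x. (x, f x)) (sampler_dist n h)"

type_synonym 'x query = "'x \<times> int \<Rightarrow> real"

text \<open>Queries and answers exchanged so far, oldest first.\<close>
type_synonym 'x history = "('x query \<times> real) list"

text \<open>A randomized adaptive analyst: the distribution of the next query, given the history.\<close>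
type_synonym 'x analyst = "'x history \<Rightarrow> 'x query pmf"


section \<open>A machine model for implementations\<close>

text \<open>
  Running time is measured on a random access machine with integer cells, real cells and cells
  that hold points of the feature space.  As in the usual real RAM, reals are exact, arithmetic
  and comparisons take unit time, and there is no rounding operation.  Integers can only be
  added and subtracted, so they have at most polynomially many digits after polynomially many
  steps, and all constants are rational, so a program text contains only finitely many bits.
  Points are opaque: they come from samples and from the sampler, and are used only by passing
  them to a query.

  Expressions have unit cost.  A program is a fixed finite text, so this changes the running
  time by at most a constant factor depending on the program.
\<close>

datatype nexp = NConst nat | NMem nexp | NAdd nexp nexp | NSub nexp nexp

datatype rexp =
    RConst rat | OfNat nexp | RMem nexp
  | RAdd rexp rexp | RSub rexp rexp | RMul rexp rexp | RDiv rexp rexp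

text \<open>
  All \<^typ>\<open>nexp\<close> arguments of commands other than the right-hand side of \<open>NStore\<close> are
  addresses or indices:
  \<^item> \<open>Coin d\<close> stores a fair random bit in integer cell \<open>d\<close>.
  \<^item> \<open>Sampler d a\<close> stores in point cell \<open>d\<close> the value of the sampler on the bits in the integer
    cells \<open>a\<close>, \<open>a + 1\<close>, \<dots>
  \<^item> \<open>Sample d b i\<close> stores the \<open>i\<close>-th sample in point cell \<open>d\<close> and its label in integer
    cell \<open>b\<close>, where \<open>1\<close> encodes the label \<open>1\<close> and \<open>0\<close> encodes the label \<open>-1\<close>.
  \<^item> \<open>Query d q a b\<close> stores in real cell \<open>d\<close> the value of the \<open>q\<close>-th query received, at the point
    in point cell \<open>a\<close> and the label encoded in integer cell \<open>b\<close>.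
  \<^item> \<open>If u v c c'\<close> branches on \<open>u \<le> v\<close>.
  \<^item> \<open>Loop u c\<close> stands for \<open>i := 1; while i \<le> u do (c; i := i + 1)\<close> with \<open>i\<close> fresh and \<open>u\<close>
    evaluated once.  There are no unbounded loops, so every program terminates.
\<close>

datatype prog =
    NStore nexp nexp
  | RStore nexp rexp
  | Coin nexp
  | Sampler nexp nexp
  | Sample nexp nexp nexp
  | Query nexp nexp nexp nexp
  | Seq prog prog
  | If rexp rexp prog prog
  | Loop rexp prog

record 'x state =
  nmem :: "nat \<Rightarrow> nat"
  rmem :: "nat \<Rightarrow> real"
  xmem :: "nat \<Rightarrow> 'x option"
  clock :: nat

text \<open>
  What a program can access but not inspect: the sampler with its input length, the samples and
  the queries received so far.  The two cost functions give the time taken by one evaluation of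
  the sampler and of a query.
\<close>
record 'x env =
  bits :: nat
  sampler :: "bool list \<Rightarrow> 'x"
  hcost :: "bool list \<Rightarrow> nat"
  qcost :: "'x query \<Rightarrow> 'x \<times> int \<Rightarrow> nat"
  samples :: "('x \<times> int) list"
  queries :: "'x query list"

primrec nval :: "'x state \<Rightarrow> nexp \<Rightarrow> nat" where
  "nval s (NConst k) = k"
| "nval s (NMem a) = nmem s (nval s a)"
| "nval s (NAdd a b) = nval s a + nval s b"
| "nval s (NSub a b) = nval s a - nval s b"

primrec rval :: "'x state \<Rightarrow> rexp \<Rightarrow> real" where
  "rval s (RConst q) = of_rat q"
| "rval s (OfNat a) = real (nval s a)"
| "rval s (RMem a) = rmem s (nval s a)"
| "rval s (RAdd u v) = rval s u + rval s v"
| "rval s (RSub u v) = rval s u - rval s v"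
| "rval s (RMul u v) = rval s u * rval s v"
| "rval s (RDiv u v) = rval s u / rval s v"

definition set_n :: "nat \<Rightarrow> nat \<Rightarrow> 'x state \<Rightarrow> 'x state" where
  "set_n a k s = s\<lparr>nmem := (nmem s)(a := k)\<rparr>"

definition set_r :: "nat \<Rightarrow> real \<Rightarrow> 'x state \<Rightarrow> 'x state" where
  "set_r a u s = s\<lparr>rmem := (rmem s)(a := u)\<rparr>"

definition set_x :: "nat \<Rightarrow> 'x \<Rightarrow> 'x state \<Rightarrow> 'x state" where
  "set_x a x s = s\<lparr>xmem := (xmem s)(a := Some x)\<rparr>"

definition tick :: "nat \<Rightarrow> 'x state \<Rightarrow> 'x state" where
  "tick k s = s\<lparr>clock := clock s + k\<rparr>"

definition label_of :: "nat \<Rightarrow> int" where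
  "label_of k = (if k = 0 then - 1 else 1)"

definition code_of :: "int \<Rightarrow> nat" where
  "code_of y = (if y = 1 then 1 else 0)"

text \<open>Reading a missing sample, a missing query or an empty point cell has no effect.\<close>

primrec exec :: "'x env \<Rightarrow> prog \<Rightarrow> 'x state \<Rightarrow> 'x state pmf" where
  "exec E (NStore d e) s = return_pmf (tick 1 (set_n (nval s d) (nval s e) s))"
| "exec E (RStore d u) s = return_pmf (tick 1 (set_r (nval s d) (rval s u) s))"
| "exec E (Coin d) s =
     map_pmf (\<lambda>c. tick 1 (set_n (nval s d) (of_bool c) s)) (pmf_of_set UNIV)"
| "exec E (Sampler d a) s =
     (let r = map (\<lambda>i. nmem s (nval s a + i) \<noteq> 0) [0..<bits E]
      in return_pmf (tick (1 + hcost E r) (set_x (nval s d) (sampler E r) s)))"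
| "exec E (Sample d b i) s =
     (if nval s i < length (samples E)
      then (case samples E ! nval s i of (x, y) \<Rightarrow>
              return_pmf (tick 1 (set_x (nval s d) x (set_n (nval s b) (code_of y) s))))
      else return_pmf (tick 1 s))"
| "exec E (Query d q a b) s =
     (case xmem s (nval s a) of
        None \<Rightarrow> return_pmf (tick 1 s)
      | Some x \<Rightarrow>
          (if nval s q < length (queries E)
           then (let \<phi> = queries E ! nval s q; z = (x, label_of (nval s b))
                 in return_pmf (tick (1 + qcost E \<phi> z) (set_r (nval s d) (\<phi> z) s)))
           else return_pmf (tick 1 s)))"
| "exec E (Seq c c') s = exec E c s \<bind> exec E c'"
| "exec E (If u v c c') s =
     (if rval s u \<le> rval s v then exec E c (tick 1 s) else exec E c' (tick 1 s))"
| "exec E (Loop u c) s =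
     ((\<lambda>p. p \<bind> (\<lambda>s'. exec E c (tick 1 s'))) ^^ nat \<lfloor>rval s u\<rfloor>) (return_pmf (tick 1 s))"


section \<open>Interaction of an implementation with an analyst\<close>

text \<open>
  An implementation of the oracle is a program that is run once per query on a memory that
  persists between queries.  Initially integer cells 0, 1, 2 contain \<open>n\<close>, the number of queries
  and the number of samples, and real cell 0 contains the tolerance.  Before each run integer
  cell 3 is set to the index of the new query; the answer is read from real cell 1.
\<close>

definition init_state :: "nat \<Rightarrow> nat \<Rightarrow> nat \<Rightarrow> real \<Rightarrow> 'x state" where
  "init_state n T m \<epsilon> =
     \<lparr>nmem = (\<lambda>_. 0)(0 := n, 1 := T, 2 := m), rmem = (\<lambda>_. 0)(0 := \<epsilon>),
      xmem = (\<lambda>_. None), clock = 0\<rparr>"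

primrec interact ::
  "prog \<Rightarrow> 'x env \<Rightarrow> 'x analyst \<Rightarrow> nat \<Rightarrow> 'x history \<Rightarrow> 'x state \<Rightarrow> ('x history \<times> 'x state) pmf"
where
  "interact P E A 0 H s = return_pmf (H, s)"
| "interact P E A (Suc k) H s = do {
     \<phi> \<leftarrow> A H;
     s' \<leftarrow> exec (E\<lparr>queries := map fst H @ [\<phi>]\<rparr>) P (set_n 3 (length H) s);
     interact P E A k (H @ [(\<phi>, rmem s' 1)]) s'
   }"

text \<open>The joint distribution of the transcript and the total running time of the program.\<close>
definition dsq_run ::
  "prog \<Rightarrow> nat \<Rightarrow> (bool list \<Rightarrow> 'x) \<Rightarrow> (bool list \<Rightarrow> nat) \<Rightarrow> ('x query \<Rightarrow> 'x \<times> int \<Rightarrow> nat)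
   \<Rightarrow> ('x \<Rightarrow> int) \<Rightarrow> real \<Rightarrow> nat \<Rightarrow> nat \<Rightarrow> 'x analyst \<Rightarrow> ('x history \<times> nat) pmf"
where
  "dsq_run P n h th tq f \<epsilon> T m A = do {
     S \<leftarrow> replicate_pmf m (labeled_dist n h f);
     (H, s) \<leftarrow> interact P
        \<lparr>bits = n - 1, sampler = h, hcost = th, qcost = tq, samples = S, queries = []\<rparr>
        A T [] (init_state n T m \<epsilon>);
     return_pmf (H, clock s)
   }"

definition dsq_correct :: "('x \<times> int) pmf \<Rightarrow> real \<Rightarrow> 'x history \<Rightarrow> bool" where
  "dsq_correct D \<epsilon> H \<longleftrightarrow>
     (\<forall>(\<phi>, v) \<in> set H. \<bar>v - measure_pmf.expectation D \<phi>\<bar> \<le> \<epsilon>)"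

text \<open>
  Efficient evaluability is a bound \<open>B\<close> on the time functions \<open>th\<close>, \<open>tq\<close>; the sampler and the
  queries are black boxes, so nothing depends on how they are computed.  With
  \<open>N = 2 ^ n\<close>, polynomial in \<open>log N\<close> means polynomial in \<open>n\<close>.  An analyst is valid if every query
  it may issue, on any history, is valid.
\<close>

definition valid_sampler ::
  "nat \<Rightarrow> 'x set \<Rightarrow> (bool list \<Rightarrow> 'x) \<Rightarrow> (bool list \<Rightarrow> nat) \<Rightarrow> nat \<Rightarrow> bool"
where
  "valid_sampler n X h th B \<longleftrightarrow> (\<forall>r. length r = n - 1 \<longrightarrow> h r \<in> X \<and> th r \<le> B)"

definition valid_query ::
  "'x set \<Rightarrow> ('x query \<Rightarrow> 'x \<times> int \<Rightarrow> nat) \<Rightarrow> nat \<Rightarrow> 'x query \<Rightarrow> bool"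
where
  "valid_query X tq B \<phi> \<longleftrightarrow> (\<forall>z \<in> X \<times> {-1, 1}. \<phi> z \<in> {-1..1} \<and> tq \<phi> z \<le> B)"

definition valid_analyst ::
  "'x set \<Rightarrow> ('x query \<Rightarrow> 'x \<times> int \<Rightarrow> nat) \<Rightarrow> nat \<Rightarrow> 'x analyst \<Rightarrow> bool"
where
  "valid_analyst X tq B A \<longleftrightarrow> (\<forall>H. \<forall>\<phi> \<in> set_pmf (A H). valid_query X tq B \<phi>)"

text \<open>
  The logarithm is clipped below at 1, which matters only if \<open>T / \<epsilon> < exp 1\<close>.  Some such
  convention is needed: for \<open>T = 1\<close> and \<open>\<epsilon> \<rightarrow> 1\<close> the unclipped rate tends to 0, which would
  allow no sample at all, and then the labelings \<open>1\<close> and \<open>-1\<close> cannot be told apart.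
\<close>
definition sample_rate :: "real \<Rightarrow> nat \<Rightarrow> real" where
  "sample_rate \<epsilon> T = (1 / \<epsilon> ^ 4) * max 1 (ln (real T / \<epsilon>))"

end

theory Submission
  imports Defs
begin

text \<open>
  Split a query as \<open>\<phi> (x, y) = \<phi>\<^sub>0 x + y * \<phi>\<^sub>1 x\<close>.  Since the feature
  distribution is known, only the correlation of \<open>f\<close> with \<open>\<phi>\<^sub>1\<close> depends on the labels.
  The implementation keeps a linear combination \<open>g\<close> of the functions \<open>\<phi>\<^sub>1\<close> of past
  queries and compares the sample mean of \<open>\<phi>\<close> with the prediction \<open>\<phi>\<^sub>0 + g * \<phi>\<^sub>1\<close>
  averaged over fresh points of the sampler.  If they agree up to \<open>3 * \<eta>\<close>, where
  \<open>\<eta> = \<epsilon> / 4\<close>, the prediction is the answer.  Otherwise \<open>g\<close> moves by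
  \<open>\<eta>\<close> along \<open>\<phi>\<^sub>1\<close>, which lowers the squared \<open>L\<^sup>2\<close> distance of \<open>g\<close> and
  \<open>f\<close> by \<open>\<eta>\<^sup>2\<close>, so this happens at most \<open>16 / \<epsilon>\<^sup>2\<close> times.

  The samples influence the interaction only through the times and signs of the updates.  Hence
  there are only \<open>(T / \<epsilon>) ^ O(1 / \<epsilon>\<^sup>2)\<close> possible courses of the interaction, and
  Hoeffding's inequality with a union bound over them handles all adaptively chosen queries.
\<close>

section \<open>Sample means\<close>

text \<open>The exponential turns the sum into a product, and independence lets one factor split off
  per entry. Nonnegative integrals spare all integrability conditions.\<close>

lemma nn_integral_exp_sum_list_replicate_pmf:
  fixes F :: "'a \<Rightarrow> real"
  assumes "(\<integral>\<^sup>+x. ennreal (exp (F x)) \<partial>measure_pmf p) \<le> ennreal B" "0 \<le> B"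
  shows "(\<integral>\<^sup>+xs. ennreal (exp (sum_list (map F xs))) \<partial>measure_pmf (replicate_pmf k p)) \<le> ennreal (B ^ k)"
proof (induction k)
  case 0
  then show ?case by simp
next
  case (Suc k)
  have "(\<integral>\<^sup>+xs. ennreal (exp (sum_list (map F xs))) \<partial>measure_pmf (replicate_pmf (Suc k) p))
      = (\<integral>\<^sup>+x. ennreal (exp (F x)) *
          (\<integral>\<^sup>+xs. ennreal (exp (sum_list (map F xs))) \<partial>measure_pmf (replicate_pmf k p)) \<partial>measure_pmf p)"
    by (simp add: exp_add ennreal_mult nn_integral_cmult)
  also have "\<dots> \<le> (\<integral>\<^sup>+x. ennreal (exp (F x)) * ennreal (B ^ k) \<partial>measure_pmf p)"
    by (intro nn_integral_mono mult_left_mono Suc) auto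
  also have "\<dots> = (\<integral>\<^sup>+x. ennreal (exp (F x)) \<partial>measure_pmf p) * ennreal (B ^ k)"
    by (simp add: nn_integral_multc)
  also have "\<dots> \<le> ennreal B * ennreal (B ^ k)"
    by (intro mult_right_mono assms) auto
  finally show ?case using assms(2) by (simp add: ennreal_mult)
qed

text \<open>Chernoff's method: Markov's inequality for the exponential of \<open>l\<close> times the
  centred sum, with Hoeffding's lemma on the interval \<open>[-c, c]\<close> for each
  factor.\<close>

lemma Hoeffding_replicate_pmf_ge:
  fixes F :: "'a \<Rightarrow> real"
  assumes bnd: "\<And>x. x \<in> set_pmf p \<Longrightarrow> \<bar>F x\<bar> \<le> c" and c: "0 < c" and t: "0 < t"
  shows "measure_pmf.prob (replicate_pmf k p)
     {xs. real k * t \<le> sum_list (map F xs) - real k * measure_pmf.expectation p F}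
    \<le> exp (- (real k * t\<^sup>2 / (2 * c\<^sup>2)))"
proof -
  \<comment> \<open>This \<open>l\<close> minimises
    \<open>l\<^sup>2 * c\<^sup>2 / 2 - l * t\<close>, the exponent per entry.\<close>
  define l where "l = t / c\<^sup>2"
  have l: "0 < l" using c t by (simp add: l_def)
  let ?\<mu> = "measure_pmf.expectation p F"
  define G where "G = (\<lambda>x. l * (F x - ?\<mu>))"
  interpret interval_bounded_random_variable "measure_pmf p" F "- c" c
    by unfold_locales (auto simp: AE_measure_pmf_iff dest!: bnd)
  have "(\<integral>\<^sup>+x. ennreal (exp (G x)) \<partial>measure_pmf p) \<le> ennreal (exp (l\<^sup>2 * (c - - c)\<^sup>2 / 8))"
    using Hoeffdings_lemma_nn_integral[OF l] by (simp add: G_def)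
  also have "l\<^sup>2 * (c - - c)\<^sup>2 / 8 = l\<^sup>2 * c\<^sup>2 / 2" by (simp add: power2_eq_square)
  finally have mgf: "(\<integral>\<^sup>+xs. ennreal (exp (sum_list (map G xs))) \<partial>measure_pmf (replicate_pmf k p))
      \<le> ennreal (exp (l\<^sup>2 * c\<^sup>2 / 2) ^ k)"
    by (rule nn_integral_exp_sum_list_replicate_pmf) simp
  have sumG: "sum_list (map G xs) = l * (sum_list (map F xs) - real k * ?\<mu>)"
    if "length xs = k" for xs
    using that by (induction xs arbitrary: k) (auto simp: G_def algebra_simps)
  let ?A = "{xs. real k * t \<le> sum_list (map F xs) - real k * ?\<mu>}"
  have "ennreal (measure_pmf.prob (replicate_pmf k p) ?A) =
      (\<integral>\<^sup>+xs. indicator ?A xs \<partial>measure_pmf (replicate_pmf k p))"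
    by (simp add: measure_pmf.emeasure_eq_measure)
  also have "\<dots> \<le> (\<integral>\<^sup>+xs. ennreal (exp (- (l * real k * t))) * ennreal (exp (sum_list (map G xs)))
      \<partial>measure_pmf (replicate_pmf k p))"
  \<comment> \<open>Markov's inequality as a pointwise bound. The formula \<open>sumG\<close> is
    available for lists of length \<open>k\<close>, hence almost everywhere.\<close>
  proof (rule nn_integral_mono_AE, unfold AE_measure_pmf_iff, rule ballI)
    fix xs assume "xs \<in> set_pmf (replicate_pmf k p)"
    hence len: "length xs = k" by (simp add: set_replicate_pmf)
    have "1 \<le> exp (- (l * real k * t)) * exp (sum_list (map G xs))" if "xs \<in> ?A"
    proof -
      have "l * (real k * t) \<le> sum_list (map G xs)"
        unfolding sumG[OF len] using that l by (intro mult_left_mono) auto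
      thus ?thesis by (simp flip: exp_add add: mult.assoc)
    qed
    thus "indicator ?A xs \<le> ennreal (exp (- (l * real k * t))) * ennreal (exp (sum_list (map G xs)))"
      by (auto simp: indicator_def ennreal_mult[symmetric] simp del: ennreal_1 simp flip: ennreal_1)
  qed
  also have "\<dots> = ennreal (exp (- (l * real k * t))) *
      (\<integral>\<^sup>+xs. ennreal (exp (sum_list (map G xs))) \<partial>measure_pmf (replicate_pmf k p))"
    by (simp add: nn_integral_cmult)
  also have "\<dots> \<le> ennreal (exp (- (l * real k * t))) * ennreal (exp (l\<^sup>2 * c\<^sup>2 / 2) ^ k)"
    by (intro mult_left_mono mgf) auto
  also have "\<dots> = ennreal (exp (- (real k * t\<^sup>2 / (2 * c\<^sup>2))))"
  proof -
    have "- (l * real k * t) + real k * (l\<^sup>2 * c\<^sup>2 / 2) = - (real k * t\<^sup>2 / (2 * c\<^sup>2))"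
      using c by (simp add: l_def field_simps power2_eq_square)
    thus ?thesis by (simp flip: ennreal_mult exp_of_nat_mult exp_add)
  qed
  finally show ?thesis by simp
qed

definition mean :: "('a \<Rightarrow> real) \<Rightarrow> 'a list \<Rightarrow> real" where
  "mean F xs = sum_list (map F xs) / real (length xs)"

text \<open>The one-sided bound is used for \<open>F\<close> and for \<open>- F\<close>, which gives
  the factor 2.\<close>

lemma Hoeffding_replicate_pmf:
  fixes F :: "'a \<Rightarrow> real"
  assumes bnd: "\<And>x. x \<in> set_pmf p \<Longrightarrow> \<bar>F x\<bar> \<le> c" and c: "0 < c" and t: "0 < t" and k: "0 < k"
  shows "measure_pmf.prob (replicate_pmf k p) {xs. t < \<bar>mean F xs - measure_pmf.expectation p F\<bar>}
    \<le> 2 * exp (- (real k * t\<^sup>2 / (2 * c\<^sup>2)))"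
proof -
  let ?q = "replicate_pmf k p"
  define A where "A = (\<lambda>F :: 'a \<Rightarrow> real.
    {xs. real k * t \<le> sum_list (map F xs) - real k * measure_pmf.expectation p F})"
  have "measure_pmf.prob ?q {xs. t < \<bar>mean F xs - measure_pmf.expectation p F\<bar>}
      \<le> measure_pmf.prob ?q (A F \<union> A (\<lambda>x. - F x))"
  proof (rule measure_pmf.finite_measure_mono_AE)
    show "AE xs in measure_pmf ?q. xs \<in> {xs. t < \<bar>mean F xs - measure_pmf.expectation p F\<bar>} \<longrightarrow>
        xs \<in> A F \<union> A (\<lambda>x. - F x)"
      unfolding AE_measure_pmf_iff
    proof (intro ballI impI)
      fix xs assume "xs \<in> set_pmf ?q" and *: "xs \<in> {xs. t < \<bar>mean F xs - measure_pmf.expectation p F\<bar>}"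
      hence len: "length xs = k" by (simp add: set_replicate_pmf)
      have neg: "sum_list (map (\<lambda>x. - F x) xs) = - sum_list (map F xs)"
        by (simp add: uminus_sum_list_map o_def)
      have "sum_list (map F xs) - real k * measure_pmf.expectation p F =
          real k * (mean F xs - measure_pmf.expectation p F)"
        using len k by (auto simp: mean_def algebra_simps)
      thus "xs \<in> A F \<union> A (\<lambda>x. - F x)"
        using * k by (simp add: A_def neg abs_if split: if_splits)
           (smt (verit, best) mult_minus_right mult_left_mono of_nat_0_le_iff)+
    qed
  qed simp
  also have "\<dots> \<le> measure_pmf.prob ?q (A F) + measure_pmf.prob ?q (A (\<lambda>x. - F x))"
    by (rule measure_Un_le) auto
  also have "\<dots> \<le> exp (- (real k * t\<^sup>2 / (2 * c\<^sup>2))) + exp (- (real k * t\<^sup>2 / (2 * c\<^sup>2)))"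
    unfolding A_def using bnd c t by (intro add_mono Hoeffding_replicate_pmf_ge) auto
  finally show ?thesis by simp
qed

section \<open>Exchanging discrete integrals and tossing coins\<close>

lemma nn_integral_pmf_commute:
  "(\<integral>\<^sup>+x. (\<integral>\<^sup>+y. F x y \<partial>measure_pmf q) \<partial>measure_pmf p) =
   (\<integral>\<^sup>+y. (\<integral>\<^sup>+x. F x y \<partial>measure_pmf p) \<partial>measure_pmf q)"
proof -
  \<comment> \<open>The iterated integral is the mean of a single distribution over
    \<open>ennreal\<close>, in which the two independent draws may change places.\<close>
  have "(\<integral>\<^sup>+x. (\<integral>\<^sup>+y. F x y \<partial>measure_pmf q) \<partial>measure_pmf p) =
      (\<integral>\<^sup>+z. z \<partial>measure_pmf (p \<bind> (\<lambda>x. q \<bind> (\<lambda>y. return_pmf (F x y)))))"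
    by simp
  also have "\<dots> = (\<integral>\<^sup>+z. z \<partial>measure_pmf (q \<bind> (\<lambda>y. p \<bind> (\<lambda>x. return_pmf (F x y)))))"
    by (subst bind_commute_pmf) simp
  finally show ?thesis by simp
qed

text \<open>The machine tosses its coins one by one, whereas \<open>sampler_dist\<close> draws a
  whole bit string uniformly; this identifies the two.\<close>

lemma replicate_pmf_coin:
  "replicate_pmf k (pmf_of_set (UNIV :: bool set)) = pmf_of_set {r. length r = k}"
proof -
  have fin: "finite {r :: bool list. length r = k}" for k
    using finite_lists_length_eq[of "UNIV :: bool set" k] by simp
  have ne: "{r :: bool list. length r = k} \<noteq> {}" for k
    using Ex_list_of_length by auto
  have card: "card {r :: bool list. length r = k} = 2 ^ k" for k
    using card_lists_length_eq[of "UNIV :: bool set" k] by simp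
  show ?thesis
  proof (induction k)
    case 0
    show ?case by (simp add: pmf_of_set_singleton)
  next
    case (Suc k)
    have "pmf (replicate_pmf (Suc k) (pmf_of_set (UNIV :: bool set))) r =
        pmf (pmf_of_set {r. length r = Suc k}) r" for r
    proof -
      have inj: "inj (\<lambda>(x::bool, xs). x # xs)" by (auto simp: inj_def)
      have eq: "replicate_pmf (Suc k) (pmf_of_set (UNIV :: bool set)) =
          map_pmf (\<lambda>(x, xs). x # xs) (pair_pmf (pmf_of_set UNIV) (pmf_of_set {r. length r = k}))"
        unfolding replicate_pmf.simps Suc.IH
        by (simp add: pair_pmf_def map_pmf_def bind_assoc_pmf bind_return_pmf)
      show ?thesis
      proof (cases r)
        case Nil
        have "[] \<notin> set_pmf (map_pmf (\<lambda>(x, xs). x # xs)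
           (pair_pmf (pmf_of_set (UNIV :: bool set)) (pmf_of_set {r :: bool list. length r = k})))" by auto
        moreover have "[] \<notin> set_pmf (pmf_of_set {r :: bool list. length r = Suc k})"
          by (subst set_pmf_of_set[OF ne fin]) simp
        ultimately show ?thesis unfolding eq Nil
          by (metis pmf_eq_0_set_pmf)
      next
        case (Cons x xs)
        have "pmf (map_pmf (\<lambda>(x, xs). x # xs) (pair_pmf (pmf_of_set UNIV) (pmf_of_set {r. length r = k}))) r =
           pmf (pair_pmf (pmf_of_set UNIV) (pmf_of_set {r. length r = k})) (x, xs)"
          using pmf_map_inj'[OF inj, of "pair_pmf (pmf_of_set UNIV) (pmf_of_set {r. length r = k})" "(x, xs)"]
          by (simp add: Cons)
        thus ?thesis unfolding eq
          by (simp add: pmf_pair pmf_of_set[OF ne fin] card Cons indicator_def)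
      qed
    qed
    thus ?case by (rule pmf_eqI)
  qed
qed

section \<open>The abstract oracle\<close>

text \<open>Subtraction on \<open>ennreal\<close> is cut off at \<open>0\<close>. This rule and the
  next carry an allowance for failures out of a probability and back, whichever of the two is
  larger.\<close>

lemma ennreal_le_minus_add: "(a :: ennreal) \<le> (a - b) + b"
proof (cases "b \<le> a")
  case False
  hence "a \<le> b" by simp
  thus ?thesis by (simp add: add_increasing)
qed (simp add: diff_add_cancel_ennreal)

lemma ennreal_minus_leI: "(a :: ennreal) \<le> c + b \<Longrightarrow> b \<noteq> top \<Longrightarrow> a - b \<le> c"
  by (auto simp: ennreal_minus_le_iff add.commute)

section \<open>The oracle as a random process, without the machine\<close>

definition half_diff :: "'x query \<Rightarrow> 'x \<Rightarrow> real" where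
  "half_diff \<phi> x = (\<phi> (x, 1) - \<phi> (x, - 1)) / 2"

text \<open>This is \<open>\<phi>\<^sub>0 + g * \<phi>\<^sub>1\<close>, where
  \<open>\<phi>\<^sub>1\<close> is \<open>half_diff \<phi>\<close>: the mean of the query under a
  random label of mean \<open>g x\<close>, continued affinely to values of \<open>g x\<close>
  outside \<open>[-1, 1]\<close>.\<close>

definition predict :: "'x query \<Rightarrow> ('x \<Rightarrow> real) \<Rightarrow> 'x \<Rightarrow> real" where
  "predict \<phi> g x = ((1 + g x) * \<phi> (x, 1) + (1 - g x) * \<phi> (x, - 1)) / 2"

text \<open>The hypothesis \<open>g\<close>, paired with the value that is returned if no later
  round replaces it.\<close>

type_synonym 'x hyp = "('x \<Rightarrow> real) \<times> real"

text \<open>The two one-sided tests are nested in the same way as in \<open>decide_prog\<close>,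
  because the machine branches on \<open>\<le>\<close> only.\<close>

definition decide :: "real \<Rightarrow> 'x query \<Rightarrow> real \<Rightarrow> real \<Rightarrow> 'x hyp \<Rightarrow> 'x hyp" where
  "decide \<eta> \<phi> p e gv =
     (if p - e \<le> 3 * \<eta>
      then if e - p \<le> 3 * \<eta> then (fst gv, e)
           else (\<lambda>x. fst gv x - \<eta> * half_diff \<phi> x, snd gv)
      else (\<lambda>x. fst gv x + \<eta> * half_diff \<phi> x, snd gv))"

definition refine ::
  "'x pmf \<Rightarrow> nat \<Rightarrow> real \<Rightarrow> ('x \<times> int) list \<Rightarrow> 'x query \<Rightarrow> 'x hyp \<Rightarrow> 'x hyp pmf" where
  "refine D m \<eta> S \<phi> gv =
     map_pmf (\<lambda>w. decide \<eta> \<phi> (mean \<phi> S) (mean (predict \<phi> (fst gv)) w) gv) (replicate_pmf m D)"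

text \<open>The number of rounds is fixed, without early exit. After an agreement, later rounds may
  replace the answer or move \<open>g\<close> again; as long as the estimates are accurate, any
  replacement is accurate too.\<close>

primrec refines ::
  "'x pmf \<Rightarrow> nat \<Rightarrow> real \<Rightarrow> ('x \<times> int) list \<Rightarrow> 'x query \<Rightarrow> nat \<Rightarrow> 'x hyp \<Rightarrow> 'x hyp pmf" where
  "refines D m \<eta> S \<phi> 0 gv = return_pmf gv"
| "refines D m \<eta> S \<phi> (Suc l) gv = refine D m \<eta> S \<phi> gv \<bind> refines D m \<eta> S \<phi> l"

primrec transcript ::
  "'x pmf \<Rightarrow> nat \<Rightarrow> real \<Rightarrow> nat \<Rightarrow> 'x analyst \<Rightarrow> ('x \<times> int) list \<Rightarrow> nat \<Rightarrow> 'x history \<Rightarrow> 'x hyp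
   \<Rightarrow> 'x history pmf" where
  "transcript D m \<eta> L A S 0 H gv = return_pmf H"
| "transcript D m \<eta> L A S (Suc k) H gv = do {
     \<phi> \<leftarrow> A H;
     gv' \<leftarrow> refines D m \<eta> S \<phi> L gv;
     transcript D m \<eta> L A S k (H @ [(\<phi>, snd gv')]) gv'
   }"

text \<open>Bounds the number of deviation events of the samples in a tree with \<open>j\<close>
  levels whose paths contain at most \<open>u\<close> updates. A path is given by the positions and
  signs of its updates, with \<open>2 * j + 1\<close> options for each, absence included; the extra
  factor counts the nodes along the paths.\<close>

definition leaves :: "nat \<Rightarrow> nat \<Rightarrow> nat" where
  "leaves j u = (2 * j + 1) ^ (u + 1)"

text \<open>A node has its own deviation event, one child without update, and one child for each
  sign of an update, with the budget reduced by one.\<close>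

lemma leaves_Suc: "1 + leaves j u + (if 0 < u then 2 * leaves j (u - 1) else 0) \<le> leaves (Suc j) u"
proof (cases u)
  case (Suc w)
  define x where "x = 2 * j + 1"
  have "1 + x ^ (w + 2) + 2 * x ^ (w + 1) \<le> (x + 2) * (x ^ (w + 1) + 1)"
    by (simp add: algebra_simps x_def)
  \<comment> \<open>Over the naturals, the strict inequality of the powers absorbs the summand
    \<open>1\<close>.\<close>
  also have "\<dots> \<le> (x + 2) * (x + 2) ^ (w + 1)"
    using power_strict_mono[of x "x + 2" "w + 1"] by (intro mult_left_mono) simp_all
  finally have "1 + x ^ (w + 2) + 2 * x ^ (w + 1) \<le> (x + 2) * (x + 2) ^ (w + 1)" .
  thus ?thesis by (simp add: Suc leaves_def x_def)
qed (simp add: leaves_def)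

section \<open>Decrease of the squared distance of hypothesis and labels\<close>

locale unknown_labels =
  fixes D :: "'x pmf" and f :: "'x \<Rightarrow> int" and \<eta> :: real
  assumes fin: "finite (set_pmf D)"
    and lab: "x \<in> set_pmf D \<Longrightarrow> f x = - 1 \<or> f x = 1"
    and eta: "0 < \<eta>"
begin

definition DF :: "('x \<times> int) pmf" where "DF = map_pmf (\<lambda>x. (x, f x)) D"

definition bounded_query :: "'x query \<Rightarrow> bool" where
  "bounded_query \<phi> \<longleftrightarrow> (\<forall>x\<in>set_pmf D. \<forall>y\<in>{- 1, 1}. \<bar>\<phi> (x, y)\<bar> \<le> 1)"

abbreviation expt :: "('x \<Rightarrow> real) \<Rightarrow> real" where "expt \<equiv> measure_pmf.expectation D"

abbreviation value_of :: "'x query \<Rightarrow> real" where "value_of \<equiv> measure_pmf.expectation DF"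

definition potential :: "('x \<Rightarrow> real) \<Rightarrow> real" where
  "potential g = expt (\<lambda>x. (of_int (f x) - g x)\<^sup>2)"

lemma integrable_D [simp, intro]: "integrable (measure_pmf D) (g :: 'x \<Rightarrow> real)"
  by (rule integrable_measure_pmf_finite[OF fin])

lemma potential_nonneg: "0 \<le> potential g"
  unfolding potential_def by (rule Bochner_Integration.integral_nonneg) simp

text \<open>For labels \<open>1\<close> and \<open>- 1\<close> the query is affine in the label, so
  the prediction errs exactly by the correlation of \<open>f - g\<close> with
  \<open>half_diff \<phi>\<close>.\<close>

lemma value_eq_predict:
  "value_of \<phi> = expt (predict \<phi> g) + expt (\<lambda>x. (of_int (f x) - g x) * half_diff \<phi> x)"
proof -
  have "value_of \<phi> = expt (\<lambda>x. \<phi> (x, f x))" by (simp add: DF_def)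
  also have "\<dots> = expt (\<lambda>x. predict \<phi> g x + (of_int (f x) - g x) * half_diff \<phi> x)"
    by (rule integral_cong_AE)
       (auto simp: AE_measure_pmf_iff predict_def half_diff_def field_simps dest!: lab)
  finally show ?thesis by simp
qed

lemma half_diff_le_1:
  assumes "bounded_query \<phi>" "x \<in> set_pmf D"
  shows "\<bar>half_diff \<phi> x\<bar> \<le> 1"
proof -
  have "\<bar>\<phi> (x, 1)\<bar> \<le> 1" "\<bar>\<phi> (x, - 1)\<bar> \<le> 1" using assms by (auto simp: bounded_query_def)
  moreover have "\<bar>(a - b) / 2\<bar> \<le> 1" if "\<bar>a\<bar> \<le> 1" "\<bar>b\<bar> \<le> 1" for a b :: real
    using that by (simp add: abs_le_iff)
  ultimately show ?thesis unfolding half_diff_def by blast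
qed

text \<open>Since \<open>g\<close> is never clipped, predictions may leave \<open>[-1, 1]\<close>;
  the bound on \<open>g\<close> determines the range that enters Hoeffding's inequality for the
  fresh points.\<close>

lemma predict_le:
  assumes "bounded_query \<phi>" "x \<in> set_pmf D" "\<bar>g x\<bar> \<le> c"
  shows "\<bar>predict \<phi> g x\<bar> \<le> 1 + c"
proof -
  have 1: "\<bar>\<phi> (x, 1)\<bar> \<le> 1" "\<bar>\<phi> (x, - 1)\<bar> \<le> 1" using assms by (auto simp: bounded_query_def)
  have "predict \<phi> g x = (\<phi> (x, 1) + \<phi> (x, - 1)) / 2 + g x * half_diff \<phi> x"
    by (simp add: predict_def half_diff_def field_simps)
  moreover have "\<bar>g x * half_diff \<phi> x\<bar> \<le> c * 1"
    unfolding abs_mult using half_diff_le_1[OF assms(1,2)] assms(3) by (intro mult_mono) auto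
  moreover have "\<bar>(a + b) / 2 + d\<bar> \<le> 1 + c" if "\<bar>a\<bar> \<le> 1" "\<bar>b\<bar> \<le> 1" "\<bar>d\<bar> \<le> c * 1"
    for a b d :: real
    using that by (simp add: abs_le_iff field_simps)
  ultimately show ?thesis using 1 by presburger
qed

text \<open>When the square is expanded, the linear term gains at least
  \<open>2 * \<eta>\<^sup>2\<close> while the quadratic term loses at most
  \<open>\<eta>\<^sup>2\<close>, as \<open>half_diff\<close> is at most \<open>1\<close> in absolute
  value.\<close>

lemma potential_update:
  assumes "bounded_query \<phi>" and s: "s = 1 \<or> s = - 1"
    and corr: "\<eta> \<le> s * expt (\<lambda>x. (of_int (f x) - g x) * half_diff \<phi> x)"
  shows "potential (\<lambda>x. g x + s * \<eta> * half_diff \<phi> x) \<le> potential g - \<eta>\<^sup>2"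
proof -
  have s2: "s\<^sup>2 = 1" using s by auto
  have "potential (\<lambda>x. g x + s * \<eta> * half_diff \<phi> x) =
     expt (\<lambda>x. (of_int (f x) - g x)\<^sup>2 - 2 * \<eta> * s * ((of_int (f x) - g x) * half_diff \<phi> x)
        + s\<^sup>2 * \<eta>\<^sup>2 * (half_diff \<phi> x)\<^sup>2)"
    unfolding potential_def
    by (rule arg_cong[where f = expt]) (simp add: fun_eq_iff power2_eq_square algebra_simps)
  also have "\<dots> = potential g - 2 * \<eta> * s * expt (\<lambda>x. (of_int (f x) - g x) * half_diff \<phi> x)
      + \<eta>\<^sup>2 * expt (\<lambda>x. (half_diff \<phi> x)\<^sup>2)"
    by (simp add: potential_def s2)
  finally have eq: "potential (\<lambda>x. g x + s * \<eta> * half_diff \<phi> x) = \<dots>" .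
  have 1: "\<eta>\<^sup>2 * expt (\<lambda>x. (half_diff \<phi> x)\<^sup>2) \<le> \<eta>\<^sup>2 * 1"
  proof -
    have "expt (\<lambda>x. (half_diff \<phi> x)\<^sup>2) \<le> expt (\<lambda>x. 1)"
      by (rule integral_mono_AE)
         (auto simp: AE_measure_pmf_iff abs_square_le_1 half_diff_le_1[OF assms(1)])
    thus ?thesis by (intro mult_left_mono) simp_all
  qed
  have "2 * \<eta> * s * expt (\<lambda>x. (of_int (f x) - g x) * half_diff \<phi> x) \<ge> 2 * \<eta> * \<eta>"
    unfolding mult.assoc using corr eta by (intro mult_left_mono) auto
  thus ?thesis using 1 unfolding eq by (simp add: power2_eq_square)
qed

text \<open>The threshold \<open>3 * \<eta>\<close> balances two accuracies of
  \<open>\<eta>\<close>. Agreement places the prediction within \<open>3 * \<eta> + \<eta>\<close>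
  of the true value; disagreement leaves, after deducting one \<open>\<eta>\<close> for each mean, a
  correlation of at least \<open>\<eta>\<close> with a known sign.\<close>

lemma decide_cases:
  assumes "bounded_query \<phi>" and p: "\<bar>p - value_of \<phi>\<bar> \<le> \<eta>" and e: "\<bar>e - expt (predict \<phi> g)\<bar> \<le> \<eta>"
  obtains "\<bar>e - value_of \<phi>\<bar> \<le> 4 * \<eta>" "decide \<eta> \<phi> p e (g, v) = (g, e)"
  | s where "s = 1 \<or> s = - 1"
      "potential (\<lambda>x. g x + s * \<eta> * half_diff \<phi> x) \<le> potential g - \<eta>\<^sup>2"
      "decide \<eta> \<phi> p e (g, v) = (\<lambda>x. g x + s * \<eta> * half_diff \<phi> x, v)"
proof -
  note eq = value_eq_predict[of \<phi> g]
  consider "\<bar>p - e\<bar> \<le> 3 * \<eta>" | "p - e > 3 * \<eta>" | "e - p > 3 * \<eta>" by linarith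
  thus ?thesis
  proof cases
    case 1
    thus ?thesis using p by (intro that(1)) (auto simp: decide_def)
  next
    case 2
    have "potential (\<lambda>x. g x + 1 * \<eta> * half_diff \<phi> x) \<le> potential g - \<eta>\<^sup>2"
      using 2 p e eq by (intro potential_update assms) auto
    thus ?thesis using 2 by (intro that(2)[of 1]) (auto simp: decide_def)
  next
    case 3
    have "potential (\<lambda>x. g x + - 1 * \<eta> * half_diff \<phi> x) \<le> potential g - \<eta>\<^sup>2"
      using 3 p e eq by (intro potential_update assms) auto
    thus ?thesis using 3 eta by (intro that(2)[of "- 1"]) (auto simp: decide_def)
  qed
qed

end

section \<open>Union bound over the branches of the interaction\<close>

locale oracle_run = unknown_labels D f \<eta> for D :: "'x pmf" and f \<eta> +
  fixes m M K L :: nat and \<beta>\<^sub>S \<beta>\<^sub>h :: real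
  assumes L: "K < L" and K: "1 \<le> real K * \<eta>\<^sup>2"
    and betas: "0 \<le> \<beta>\<^sub>S" "0 \<le> \<beta>\<^sub>h"
    and sample_dev: "\<And>\<phi>. bounded_query \<phi> \<Longrightarrow>
      measure_pmf.prob (replicate_pmf M DF) {S. \<eta> < \<bar>mean \<phi> S - value_of \<phi>\<bar>} \<le> \<beta>\<^sub>S"
    and estimate_dev: "\<And>\<phi> g. bounded_query \<phi> \<Longrightarrow> (\<And>x. x \<in> set_pmf D \<Longrightarrow> \<bar>g x\<bar> \<le> real K * \<eta>) \<Longrightarrow>
      measure_pmf.prob (replicate_pmf m D) {w. \<eta> < \<bar>mean (predict \<phi> g) w - expt (predict \<phi> g)\<bar>} \<le> \<beta>\<^sub>h"
begin

text \<open>\<open>u\<close> is the number of updates still possible. The at most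
  \<open>K - u\<close> past ones changed \<open>g\<close> by at most \<open>\<eta>\<close> each,
  which keeps \<open>g\<close> in the range required by \<open>estimate_dev\<close>;
  \<open>K < L\<close> will force an agreement among the \<open>L\<close> rounds of a query.\<close>

definition within_budget :: "nat \<Rightarrow> ('x \<Rightarrow> real) \<Rightarrow> bool" where
  "within_budget u g \<longleftrightarrow> potential g \<le> real u * \<eta>\<^sup>2 \<and> u \<le> K \<and>
     (\<forall>x\<in>set_pmf D. \<bar>g x\<bar> \<le> (real K - real u) * \<eta>)"

abbreviation samples_pmf :: "('x \<times> int) list pmf" where "samples_pmf \<equiv> replicate_pmf M DF"

lemma within_budget_update:
  assumes "within_budget u g" "bounded_query \<phi>" "s = 1 \<or> s = - 1" "0 < u"
    and "potential (\<lambda>x. g x + s * \<eta> * half_diff \<phi> x) \<le> real (u - 1) * \<eta>\<^sup>2"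
  shows "within_budget (u - 1) (\<lambda>x. g x + s * \<eta> * half_diff \<phi> x)"
proof -
  have "\<bar>g x + s * \<eta> * half_diff \<phi> x\<bar> \<le> (real K - real (u - 1)) * \<eta>" if x: "x \<in> set_pmf D" for x
  proof -
    have "\<bar>g x\<bar> \<le> (real K - real u) * \<eta>" using assms(1) x by (auto simp: within_budget_def)
    moreover have "\<bar>s * \<eta> * half_diff \<phi> x\<bar> \<le> \<eta>"
      using half_diff_le_1[OF assms(2) x] assms(3) eta by (auto simp: abs_mult)
    ultimately have "\<bar>g x + s * \<eta> * half_diff \<phi> x\<bar> \<le> (real K - real u) * \<eta> + \<eta>" by linarith
    also have "\<dots> = (real K - real (u - 1)) * \<eta>"
      using assms(4) by (simp add: of_nat_diff algebra_simps)
    finally show ?thesis .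
  qed
  thus ?thesis using assms by (auto simp: within_budget_def)
qed

text \<open>
  Only the samples decide which of the three branches of a step is taken.  Summing the failure
  over all branches that are sound for the true distribution makes the continuation independent
  of the samples, so that the integral over the samples can be pulled inside.  The failures of the
  estimates from fresh points of the sampler must not be multiplied by the number of branches and
  are subtracted beforehand.
\<close>
lemma refines_failure:
  fixes F :: "('x \<times> int) list \<Rightarrow> 'x hyp \<Rightarrow> ennreal" and c :: ennreal
  assumes \<phi>: "bounded_query \<phi>" and c: "c \<noteq> top" and F_le_1: "\<And>S gv. F S gv \<le> 1"
    and F: "\<And>u g v. within_budget u g \<Longrightarrow> \<bar>v - value_of \<phi>\<bar> \<le> 4 * \<eta> \<Longrightarrow>
       (\<integral>\<^sup>+S. F S (g, v) - c \<partial>measure_pmf samples_pmf) \<le> ennreal \<beta>\<^sub>S * of_nat (leaves j u)"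
    and "within_budget u g" and "\<bar>v - value_of \<phi>\<bar> \<le> 4 * \<eta> \<or> u < l"
  shows "(\<integral>\<^sup>+S. (\<integral>\<^sup>+gv. F S gv \<partial>measure_pmf (refines D m \<eta> S \<phi> l (g, v)))
       - (c + of_nat l * ennreal \<beta>\<^sub>h) \<partial>measure_pmf samples_pmf)
     \<le> ennreal \<beta>\<^sub>S * of_nat (leaves (j + l) u)"
  using assms(5,6)
proof (induction l arbitrary: u g v)
  case 0
  \<comment> \<open>With no rounds left, \<open>u < l\<close> is impossible, so \<open>v\<close> is
    accurate and \<open>F\<close> applies.\<close>
  thus ?case using F[of u g v] by simp
next
  case (Suc l)
  define I where "I = (\<lambda>S gv. \<integral>\<^sup>+gv'. F S gv' \<partial>measure_pmf (refines D m \<eta> S \<phi> l gv))"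
  define c' where "c' = c + of_nat l * ennreal \<beta>\<^sub>h"
  define G where "G = (\<lambda>s x. g x + s * \<eta> * half_diff \<phi> x)"
  define est where "est = (\<lambda>w. mean (predict \<phi> g) w)"
  \<comment> \<open>The excess failure of each branch, set to \<open>0\<close> unless the branch is
    sound for the true distribution. These conditions do not mention \<open>S\<close>, so the
    branches can be integrated over the samples one by one.\<close>
  define T0 where "T0 = (\<lambda>S w. if \<bar>est w - value_of \<phi>\<bar> \<le> 4 * \<eta> then I S (g, est w) - c' else 0)"
  define T where "T = (\<lambda>s S. if 0 < u \<and> potential (G s) \<le> real (u - 1) * \<eta>\<^sup>2
    then I S (G s, v) - c' else 0)"
  let ?badS = "{S. \<eta> < \<bar>mean \<phi> S - value_of \<phi>\<bar>}"
  let ?badh = "{w. \<eta> < \<bar>est w - expt (predict \<phi> g)\<bar>}"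
  let ?W = "measure_pmf (replicate_pmf m D)"
  let ?P = "measure_pmf samples_pmf"
  have I1: "I S gv \<le> 1" for S gv
  proof -
    have "I S gv \<le> (\<integral>\<^sup>+gv'. 1 \<partial>measure_pmf (refines D m \<eta> S \<phi> l gv))"
      unfolding I_def by (intro nn_integral_mono F_le_1)
    thus ?thesis by (simp add: measure_pmf.emeasure_space_1)
  qed
  \<comment> \<open>Outside the two bad events \<open>decide_cases\<close> shows that the branch
    taken is a sound one; inside them an indicator already reaches the trivial bound
    \<open>1\<close>.\<close>
  have step: "I S (decide \<eta> \<phi> (mean \<phi> S) (est w) (g, v))
      \<le> indicator ?badS S + indicator ?badh w + c' + (T0 S w + T 1 S + T (- 1) S)" for S w
  proof (cases "S \<in> ?badS \<or> w \<in> ?badh")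
    case True
    hence "1 \<le> (indicator ?badS S + indicator ?badh w :: ennreal)"
      by (auto simp: indicator_def)
    thus ?thesis using I1 by (meson add_increasing2 order_trans zero_le)
  next
    case False
    hence p: "\<bar>mean \<phi> S - value_of \<phi>\<bar> \<le> \<eta>" and e: "\<bar>est w - expt (predict \<phi> g)\<bar> \<le> \<eta>" by auto
    have "I S (decide \<eta> \<phi> (mean \<phi> S) (est w) (g, v)) \<le> (T0 S w + T 1 S + T (- 1) S) + c'"
    proof (rule decide_cases[OF \<phi> p e, where v = v])
      assume *: "\<bar>est w - value_of \<phi>\<bar> \<le> 4 * \<eta>"
        "decide \<eta> \<phi> (mean \<phi> S) (est w) (g, v) = (g, est w)"
      have "I S (g, est w) \<le> T0 S w + c'"
        unfolding T0_def using * by (simp add: ennreal_le_minus_add)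
      also have "\<dots> \<le> (T0 S w + T 1 S + T (- 1) S) + c'"
        by (intro add_right_mono) (simp add: add.assoc)
      finally show ?thesis using * by simp
    next
      fix s :: real
      assume s: "s = 1 \<or> s = - 1"
        and pot: "potential (\<lambda>x. g x + s * \<eta> * half_diff \<phi> x) \<le> potential g - \<eta>\<^sup>2"
        and eq: "decide \<eta> \<phi> (mean \<phi> S) (est w) (g, v) = (\<lambda>x. g x + s * \<eta> * half_diff \<phi> x, v)"
      have "0 \<le> potential g - \<eta>\<^sup>2" using pot potential_nonneg order_trans by blast
      moreover have pg: "potential g \<le> real u * \<eta>\<^sup>2" using Suc.prems by (simp add: within_budget_def)
      \<comment> \<open>The potential cannot drop below \<open>0\<close>, so an update is impossible
        once the budget is used up.\<close>
      ultimately have "u \<noteq> 0"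
        using zero_less_power[OF eta, of 2] by (intro notI) simp
      moreover from this have "potential (G s) \<le> real (u - 1) * \<eta>\<^sup>2"
        using pot pg by (simp add: G_def of_nat_diff algebra_simps)
      ultimately have "I S (G s, v) \<le> T s S + c'"
        by (simp add: T_def ennreal_le_minus_add)
      also have "T s S \<le> T0 S w + T 1 S + T (- 1) S"
        using s by (auto simp: add_increasing add_increasing2)
      finally show ?thesis unfolding eq by (simp add: G_def add_right_mono)
    qed
    thus ?thesis using False by (simp add: add.commute)
  qed
  have badh: "(\<integral>\<^sup>+w. indicator ?badh w \<partial>?W) \<le> ennreal \<beta>\<^sub>h"
  proof -
    have "\<bar>g x\<bar> \<le> real K * \<eta>" if "x \<in> set_pmf D" for x
    proof -
      have "\<bar>g x\<bar> \<le> (real K - real u) * \<eta>" using Suc.prems that by (auto simp: within_budget_def)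
      also have "\<dots> \<le> real K * \<eta>" using eta by (intro mult_right_mono) auto
      finally show ?thesis .
    qed
    from estimate_dev[OF \<phi> this] show ?thesis
      by (simp add: measure_pmf.emeasure_eq_measure est_def ennreal_leI)
  qed
  have badS: "(\<integral>\<^sup>+S. indicator ?badS S \<partial>?P) \<le> ennreal \<beta>\<^sub>S"
    using sample_dev[OF \<phi>] by (simp add: measure_pmf.emeasure_eq_measure ennreal_leI)
  have T: "(\<integral>\<^sup>+S. T s S \<partial>?P) \<le> ennreal \<beta>\<^sub>S * of_nat (if 0 < u then leaves (j + l) (u - 1) else 0)"
    if "s = 1 \<or> s = - 1" for s
  proof (cases "0 < u \<and> potential (G s) \<le> real (u - 1) * \<eta>\<^sup>2")
    case True
    hence "within_budget (u - 1) (G s)"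
      unfolding G_def using Suc.prems \<phi> that by (intro within_budget_update) auto
    \<comment> \<open>An update costs one round and one unit of the budget, which preserves the
      second disjunct.\<close>
    moreover have "\<bar>v - value_of \<phi>\<bar> \<le> 4 * \<eta> \<or> u - 1 < l" using Suc.prems True by auto
    ultimately show ?thesis using Suc.IH[of "u - 1" "G s" v] True
      by (simp only: T_def I_def c'_def if_True simp_thms)
  qed (auto simp: T_def)
  \<comment> \<open>This branch records an accurate answer, so the premise of the induction
    hypothesis holds by its first disjunct.\<close>
  have T0: "(\<integral>\<^sup>+S. T0 S w \<partial>?P) \<le> ennreal \<beta>\<^sub>S * of_nat (leaves (j + l) u)" for w
    using Suc.IH[of u g "est w"] Suc.prems(1) unfolding T0_def I_def c'_def
    by (cases "\<bar>est w - value_of \<phi>\<bar> \<le> 4 * \<eta>") simp_all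
  have "(\<integral>\<^sup>+S. (\<integral>\<^sup>+gv. F S gv \<partial>measure_pmf (refines D m \<eta> S \<phi> (Suc l) (g, v)))
       - (c + of_nat (Suc l) * ennreal \<beta>\<^sub>h) \<partial>?P)
     = (\<integral>\<^sup>+S. (\<integral>\<^sup>+w. I S (decide \<eta> \<phi> (mean \<phi> S) (est w) (g, v)) \<partial>?W) - (ennreal \<beta>\<^sub>h + c') \<partial>?P)"
    by (simp add: refine_def I_def est_def c'_def algebra_simps)
  \<comment> \<open>The bad event of the fresh points is cancelled against its allowance
    \<open>\<beta>\<^sub>h\<close> for each fixed \<open>S\<close>, before the branches are
    integrated over the samples.\<close>
  also have "\<dots> \<le> (\<integral>\<^sup>+S. indicator ?badS S + ((\<integral>\<^sup>+w. T0 S w \<partial>?W) + T 1 S + T (- 1) S) \<partial>?P)"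
  proof (intro nn_integral_mono ennreal_minus_leI)
    fix S
    have "(\<integral>\<^sup>+w. I S (decide \<eta> \<phi> (mean \<phi> S) (est w) (g, v)) \<partial>?W)
       \<le> (\<integral>\<^sup>+w. indicator ?badS S + indicator ?badh w + c' + (T0 S w + T 1 S + T (- 1) S) \<partial>?W)"
      by (intro nn_integral_mono step)
    also have "\<dots> = indicator ?badS S + (\<integral>\<^sup>+w. indicator ?badh w \<partial>?W) + c'
        + ((\<integral>\<^sup>+w. T0 S w \<partial>?W) + T 1 S + T (- 1) S)"
      by (simp add: nn_integral_add measure_pmf.emeasure_space_1)
    also have "\<dots> \<le> indicator ?badS S + ennreal \<beta>\<^sub>h + c'
        + ((\<integral>\<^sup>+w. T0 S w \<partial>?W) + T 1 S + T (- 1) S)"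
      by (intro add_mono badh order_refl)
    finally show "(\<integral>\<^sup>+w. I S (decide \<eta> \<phi> (mean \<phi> S) (est w) (g, v)) \<partial>?W)
      \<le> indicator ?badS S + ((\<integral>\<^sup>+w. T0 S w \<partial>?W) + T 1 S + T (- 1) S) + (ennreal \<beta>\<^sub>h + c')"
      by (simp add: ac_simps)
    show "ennreal \<beta>\<^sub>h + c' \<noteq> top"
      using c by (simp add: c'_def ennreal_mult_eq_top_iff)
  qed
  \<comment> \<open>With \<open>w\<close> on the outside, hypothesis and answer are fixed while the
    samples are integrated out.\<close>
  also have "\<dots> = (\<integral>\<^sup>+S. indicator ?badS S \<partial>?P) + ((\<integral>\<^sup>+w. (\<integral>\<^sup>+S. T0 S w \<partial>?P) \<partial>?W)
      + (\<integral>\<^sup>+S. T 1 S \<partial>?P) + (\<integral>\<^sup>+S. T (- 1) S \<partial>?P))"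
    by (subst nn_integral_pmf_commute) (simp add: nn_integral_add)
  also have "\<dots> \<le> ennreal \<beta>\<^sub>S + ((\<integral>\<^sup>+w. ennreal \<beta>\<^sub>S * of_nat (leaves (j + l) u) \<partial>?W)
      + ennreal \<beta>\<^sub>S * of_nat (if 0 < u then leaves (j + l) (u - 1) else 0)
      + ennreal \<beta>\<^sub>S * of_nat (if 0 < u then leaves (j + l) (u - 1) else 0))"
    by (intro add_mono badS T T0 nn_integral_mono) auto
  also have "\<dots> = ennreal \<beta>\<^sub>S * of_nat (1 + leaves (j + l) u +
      (if 0 < u then 2 * leaves (j + l) (u - 1) else 0))"
    by (simp add: measure_pmf.emeasure_space_1 algebra_simps mult_2)
  also have "\<dots> \<le> ennreal \<beta>\<^sub>S * of_nat (leaves (j + Suc l) u)"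
    unfolding add_Suc_right by (intro mult_left_mono of_nat_mono leaves_Suc) simp
  finally show ?case .
qed

text \<open>Chains \<open>refines_failure\<close> over the queries, with the later interaction in
  the role of \<open>F\<close>, so that all rounds form one tree of \<open>k * L\<close> levels. A
  query is drawn from the history alone, hence its integral commutes with that over the
  samples.\<close>

lemma transcript_failure:
  fixes A :: "'x analyst"
  assumes A: "\<And>H \<phi>. \<phi> \<in> set_pmf (A H) \<Longrightarrow> bounded_query \<phi>"
    and "within_budget u g" and "dsq_correct DF (4 * \<eta>) H"
  shows "(\<integral>\<^sup>+S. emeasure (measure_pmf (transcript D m \<eta> L A S k H (g, v))) {H. \<not> dsq_correct DF (4 * \<eta>) H}
       - of_nat (k * L) * ennreal \<beta>\<^sub>h \<partial>measure_pmf samples_pmf)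
     \<le> ennreal \<beta>\<^sub>S * of_nat (leaves (k * L) u)"
  using assms(2,3)
proof (induction k arbitrary: H u g v)
  case 0
  thus ?case by (simp add: indicator_def)
next
  case (Suc k)
  define F where "F = (\<lambda>\<phi> S gv. emeasure (measure_pmf (transcript D m \<eta> L A S k (H @ [(\<phi>, snd gv)]) gv))
    {H. \<not> dsq_correct DF (4 * \<eta>) H})"
  define J where "J = (\<lambda>\<phi> S. \<integral>\<^sup>+gv. F \<phi> S gv \<partial>measure_pmf (refines D m \<eta> S \<phi> L (g, v)))"
  let ?P = "measure_pmf samples_pmf"
  define c where "c = of_nat (k * L) * ennreal \<beta>\<^sub>h + of_nat L * ennreal \<beta>\<^sub>h"
  have c: "of_nat (Suc k * L) * ennreal \<beta>\<^sub>h = c" by (simp add: c_def algebra_simps)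
  have "(\<integral>\<^sup>+S. emeasure (measure_pmf (transcript D m \<eta> L A S (Suc k) H (g, v))) {H. \<not> dsq_correct DF (4 * \<eta>) H}
       - of_nat (Suc k * L) * ennreal \<beta>\<^sub>h \<partial>?P) = (\<integral>\<^sup>+S. (\<integral>\<^sup>+\<phi>. J \<phi> S \<partial>measure_pmf (A H)) - c \<partial>?P)"
    unfolding c by (simp add: F_def J_def)
  also have "\<dots> \<le> (\<integral>\<^sup>+S. (\<integral>\<^sup>+\<phi>. J \<phi> S - c \<partial>measure_pmf (A H)) \<partial>?P)"
  proof (intro nn_integral_mono ennreal_minus_leI)
    fix S
    have "(\<integral>\<^sup>+\<phi>. J \<phi> S \<partial>measure_pmf (A H)) \<le> (\<integral>\<^sup>+\<phi>. (J \<phi> S - c) + c \<partial>measure_pmf (A H))"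
      by (intro nn_integral_mono ennreal_le_minus_add)
    thus "(\<integral>\<^sup>+\<phi>. J \<phi> S \<partial>measure_pmf (A H)) \<le> (\<integral>\<^sup>+\<phi>. J \<phi> S - c \<partial>measure_pmf (A H)) + c"
      by (simp add: nn_integral_add measure_pmf.emeasure_space_1)
    show "c \<noteq> top" by (simp add: c_def ennreal_mult_eq_top_iff)
  qed
  also have "\<dots> = (\<integral>\<^sup>+\<phi>. (\<integral>\<^sup>+S. J \<phi> S - c \<partial>?P) \<partial>measure_pmf (A H))"
    by (rule nn_integral_pmf_commute)
  also have "\<dots> \<le> (\<integral>\<^sup>+\<phi>. ennreal \<beta>\<^sub>S * of_nat (leaves (Suc k * L) u) \<partial>measure_pmf (A H))"
  proof (rule nn_integral_mono_AE, unfold AE_measure_pmf_iff, rule ballI)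
    fix \<phi> assume "\<phi> \<in> set_pmf (A H)"
    hence \<phi>: "bounded_query \<phi>" by (rule A)
    have "(\<integral>\<^sup>+S. J \<phi> S - c \<partial>?P) \<le> ennreal \<beta>\<^sub>S * of_nat (leaves (k * L + L) u)"
      unfolding J_def c_def
    proof (rule refines_failure[OF \<phi>])
      show "of_nat (k * L) * ennreal \<beta>\<^sub>h \<noteq> top" by (simp add: ennreal_mult_eq_top_iff)
      show "F \<phi> S gv \<le> 1" for S gv
        unfolding F_def by (rule measure_pmf.emeasure_le_1)
      show "within_budget u g" by fact
      \<comment> \<open>The value \<open>v\<close> dates from before this query; the second disjunct
        holds by \<open>u \<le> K < L\<close>.\<close>
      show "\<bar>v - value_of \<phi>\<bar> \<le> 4 * \<eta> \<or> u < L"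
        using L Suc.prems by (auto simp: within_budget_def)
    next
      fix u' g' v'
      assume "within_budget u' g'" "\<bar>v' - value_of \<phi>\<bar> \<le> 4 * \<eta>"
      thus "(\<integral>\<^sup>+S. F \<phi> S (g', v') - of_nat (k * L) * ennreal \<beta>\<^sub>h \<partial>?P)
         \<le> ennreal \<beta>\<^sub>S * of_nat (leaves (k * L) u')"
        unfolding F_def snd_conv using Suc.prems by (intro Suc.IH) (auto simp: dsq_correct_def)
    qed
    thus "(\<integral>\<^sup>+S. J \<phi> S - c \<partial>?P) \<le> ennreal \<beta>\<^sub>S * of_nat (leaves (Suc k * L) u)"
      by (simp add: add.commute)
  qed
  also have "\<dots> = ennreal \<beta>\<^sub>S * of_nat (leaves (Suc k * L) u)"
    by (simp add: measure_pmf.emeasure_space_1)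
  finally show ?case .
qed

text \<open>The initial hypothesis \<open>0\<close> has potential \<open>1\<close>, the mean of the
  squared labels, and thus budget \<open>K\<close>. Adding the subtracted allowance back yields the
  sum of the two failure bounds.\<close>

lemma transcript_correct:
  fixes A :: "'x analyst"
  assumes A: "\<And>H \<phi>. \<phi> \<in> set_pmf (A H) \<Longrightarrow> bounded_query \<phi>"
  shows "measure_pmf.prob (samples_pmf \<bind> (\<lambda>S. transcript D m \<eta> L A S T [] (\<lambda>_. 0, v)))
       {H. \<not> dsq_correct DF (4 * \<eta>) H}
     \<le> real (T * L) * \<beta>\<^sub>h + \<beta>\<^sub>S * real (leaves (T * L) K)"
proof -
  let ?P = "measure_pmf samples_pmf"
  define F where "F = (\<lambda>S. emeasure (measure_pmf (transcript D m \<eta> L A S T [] (\<lambda>_. 0, v)))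
    {H. \<not> dsq_correct DF (4 * \<eta>) H})"
  define c where "c = of_nat (T * L) * ennreal \<beta>\<^sub>h"
  have "expt (\<lambda>x. (of_int (f x))\<^sup>2) = expt (\<lambda>x. 1)"
    by (rule integral_cong_AE) (auto simp: AE_measure_pmf_iff dest!: lab)
  hence "within_budget K (\<lambda>_. 0)" using K by (simp add: within_budget_def potential_def)
  hence *: "(\<integral>\<^sup>+S. F S - c \<partial>?P) \<le> ennreal \<beta>\<^sub>S * of_nat (leaves (T * L) K)"
    unfolding F_def c_def by (intro transcript_failure A) (auto simp: dsq_correct_def)
  have "emeasure (measure_pmf (samples_pmf \<bind> (\<lambda>S. transcript D m \<eta> L A S T [] (\<lambda>_. 0, v))))
       {H. \<not> dsq_correct DF (4 * \<eta>) H} = (\<integral>\<^sup>+S. F S \<partial>?P)"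
    by (simp add: F_def)
  also have "\<dots> \<le> (\<integral>\<^sup>+S. (F S - c) + c \<partial>?P)"
    by (intro nn_integral_mono ennreal_le_minus_add)
  also have "\<dots> = (\<integral>\<^sup>+S. F S - c \<partial>?P) + c"
    by (simp add: nn_integral_add measure_pmf.emeasure_space_1)
  also have "\<dots> \<le> ennreal \<beta>\<^sub>S * of_nat (leaves (T * L) K) + c"
    by (intro add_right_mono *)
  also have "\<dots> = ennreal (real (T * L) * \<beta>\<^sub>h + \<beta>\<^sub>S * real (leaves (T * L) K))"
    using betas by (simp add: c_def ennreal_mult ennreal_plus add.commute flip: ennreal_of_nat_eq_real_of_nat)
  finally show ?thesis
    using betas by (simp add: measure_pmf.emeasure_eq_measure del: ennreal_plus)
qed

end

section \<open>The program\<close>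

notation Seq (infixr ";;" 60)

abbreviation (input) num :: "nat \<Rightarrow> nexp" where "num \<equiv> NConst"
abbreviation (input) cell :: "nat \<Rightarrow> nexp" where "cell k \<equiv> NMem (NConst k)"
abbreviation (input) reg :: "nat \<Rightarrow> rexp" where "reg k \<equiv> RMem (NConst k)"
abbreviation (input) coef :: "nexp \<Rightarrow> nexp" where "coef i \<equiv> NAdd (num 100) i"

text \<open>
  Integer cells: 5 index of the sample, 6 its label, 7 number of coins tossed, 8 index of the
  query in the sum for \<open>g\<close>, 9 number of fresh points.  Real cells: 2 sample sum, 3 query
  value, 4 sum of predictions, 5 value of \<open>g\<close>, 6 and 7 the query at the two labels.  From 100
  on, integer cells hold the coins and real cells the coefficients of \<open>g\<close>, one for each
  query.
\<close>
definition sample_body :: prog where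
  "sample_body =
     Sample (num 0) (num 6) (cell 5) ;;
     Query (num 3) (cell 3) (num 0) (cell 6) ;;
     RStore (num 2) (RAdd (reg 2) (reg 3)) ;;
     NStore (num 5) (NAdd (cell 5) (num 1))"

definition sample_sum :: prog where
  "sample_sum =
     RStore (num 2) (RConst 0) ;; NStore (num 5) (num 0) ;; Loop (OfNat (cell 2)) sample_body"

definition coin_body :: prog where
  "coin_body = Coin (NAdd (num 100) (cell 7)) ;; NStore (num 7) (NAdd (cell 7) (num 1))"

definition draw :: prog where
  "draw =
     NStore (num 7) (num 0) ;;
     Loop (OfNat (NSub (cell 0) (num 1))) coin_body ;;
     Sampler (num 1) (num 100)"

definition hyp_body :: prog where
  "hyp_body =
     Query (num 6) (cell 8) (num 1) (num 1) ;;
     Query (num 7) (cell 8) (num 1) (num 0) ;;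
     RStore (num 5) (RAdd (reg 5)
       (RMul (RMem (coef (cell 8))) (RDiv (RSub (reg 6) (reg 7)) (RConst 2)))) ;;
     NStore (num 8) (NAdd (cell 8) (num 1))"

text \<open>The sum includes the current query, whose coefficient may have changed in earlier
  rounds. Being the last term, it leaves its two values at the drawn point in real cells 6 and 7,
  where \<open>predict_body\<close> reads them.\<close>

definition hyp_value :: prog where
  "hyp_value =
     RStore (num 5) (RConst 0) ;; NStore (num 8) (num 0) ;;
     Loop (OfNat (NAdd (cell 3) (num 1))) hyp_body"

definition predict_body :: prog where
  "predict_body =
     draw ;; hyp_value ;;
     RStore (num 4) (RAdd (reg 4) (RDiv
       (RAdd (RMul (RAdd (RConst 1) (reg 5)) (reg 6)) (RMul (RSub (RConst 1) (reg 5)) (reg 7)))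
       (RConst 2))) ;;
     NStore (num 9) (NAdd (cell 9) (num 1))"

text \<open>Fresh points cost time but no samples. Their number
  \<open>q * T / \<epsilon> ^ 6\<close> is a rational expression, as the machine has no logarithm,
  and integer cell 9 counts them because the rounded loop bound is not stored anywhere.\<close>

definition predict_sum :: "nat \<Rightarrow> prog" where
  "predict_sum q =
     RStore (num 4) (RConst 0) ;; NStore (num 9) (num 0) ;;
     Loop (RDiv (RMul (RConst (of_nat q)) (OfNat (cell 1)))
       (RMul (RMul (reg 0) (RMul (reg 0) (reg 0))) (RMul (reg 0) (RMul (reg 0) (reg 0)))))
       predict_body"

definition decide_prog :: prog where
  "decide_prog =
     If (RSub (reg 2) (reg 4)) (RMul (RConst 3) (RDiv (reg 0) (RConst 4)))
       (If (RSub (reg 4) (reg 2)) (RMul (RConst 3) (RDiv (reg 0) (RConst 4)))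
         (RStore (num 1) (reg 4))
         (RStore (coef (cell 3)) (RSub (RMem (coef (cell 3))) (RDiv (reg 0) (RConst 4)))))
       (RStore (coef (cell 3)) (RAdd (RMem (coef (cell 3))) (RDiv (reg 0) (RConst 4))))"

definition refine_prog :: "nat \<Rightarrow> prog" where
  "refine_prog q =
     sample_sum ;; predict_sum q ;;
     RStore (num 2) (RDiv (reg 2) (OfNat (cell 2))) ;;
     RStore (num 4) (RDiv (reg 4) (OfNat (cell 9))) ;;
     decide_prog"

text \<open>Loop bounds are rounded down; the summand \<open>2\<close> makes the number of rounds
  exceed \<open>16 / \<epsilon>\<^sup>2\<close> rounded up.\<close>

definition oracle_prog :: "nat \<Rightarrow> prog" where
  "oracle_prog q =
     Loop (RAdd (RDiv (RConst 16) (RMul (reg 0) (reg 0))) (RConst 2)) (refine_prog q)"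

section \<open>Loops, frame conditions and time bounds\<close>

lemma state_simps [simp]:
  "nmem (set_n a k s) = (nmem s)(a := k)" "rmem (set_n a k s) = rmem s"
  "xmem (set_n a k s) = xmem s" "clock (set_n a k s) = clock s"
  "nmem (set_r a u s) = nmem s" "rmem (set_r a u s) = (rmem s)(a := u)"
  "xmem (set_r a u s) = xmem s" "clock (set_r a u s) = clock s"
  "nmem (set_x a x s) = nmem s" "rmem (set_x a x s) = rmem s"
  "xmem (set_x a x s) = (xmem s)(a := Some x)" "clock (set_x a x s) = clock s"
  "nmem (tick c s) = nmem s" "rmem (tick c s) = rmem s"
  "xmem (tick c s) = xmem s" "clock (tick c s) = clock s + c"
  by (simp_all add: set_n_def set_r_def set_x_def tick_def)

text \<open>The semantics of \<open>Loop\<close> appends each pass at the end; this form splits off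
  the first pass, as inductions over the starting state require.\<close>

primrec iter :: "'x env \<Rightarrow> prog \<Rightarrow> nat \<Rightarrow> 'x state \<Rightarrow> 'x state pmf" where
  "iter E c 0 s = return_pmf s"
| "iter E c (Suc k) s = exec E c (tick 1 s) \<bind> iter E c k"

lemma funpow_bind_eq_iter:
  "((\<lambda>p. p \<bind> (\<lambda>s. exec E c (tick 1 s))) ^^ k) p = p \<bind> iter E c k"
proof (induction k arbitrary: p)
  case (Suc k)
  show ?case unfolding funpow_Suc_right o_def Suc
    by (simp add: bind_assoc_pmf)
next
  case 0
  have "iter E c 0 = return_pmf" by (rule ext) simp
  thus ?case by (simp only: funpow_0 bind_return_pmf')
qed

lemma exec_Loop: "exec E (Loop u c) s = iter E c (nat \<lfloor>rval s u\<rfloor>) (tick 1 s)"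
  unfolding exec.simps funpow_bind_eq_iter bind_return_pmf ..

declare exec.simps(9) [simp del]
declare exec_Loop [simp]

text \<open>Frame condition, with \<open>N\<close> and \<open>R\<close> the cells that may change.
  Point cells are left out: the program writes them anew before it reads them.\<close>

definition agree :: "nat set \<Rightarrow> nat set \<Rightarrow> 'x state \<Rightarrow> 'x state \<Rightarrow> bool" where
  "agree N R s s' \<longleftrightarrow> (\<forall>a. a \<notin> N \<longrightarrow> nmem s' a = nmem s a) \<and> (\<forall>a. a \<notin> R \<longrightarrow> rmem s' a = rmem s a)"

lemma agree_trans: "agree N R s s' \<Longrightarrow> agree N R s' s'' \<Longrightarrow> agree N R s s''"
  by (simp add: agree_def)

lemma agree_nmem: "agree N R s s' \<Longrightarrow> a \<notin> N \<Longrightarrow> nmem s' a = nmem s a"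
  and agree_rmem: "agree N R s s' \<Longrightarrow> a \<notin> R \<Longrightarrow> rmem s' a = rmem s a"
  by (simp_all add: agree_def)

lemma rel_pmf_mono:
  assumes "rel_pmf R p q" "\<And>x y. R x y \<Longrightarrow> R' x y"
  shows "rel_pmf R' p q"
  by (rule pmf.rel_mono_strong[OF assms(1)]) (rule assms(2))

definition hypothesis :: "'x query list \<Rightarrow> 'x state \<Rightarrow> 'x \<Rightarrow> real" where
  "hypothesis qs s x = (\<Sum>j<length qs. rmem s (100 + j) * half_diff (qs ! j) x)"

lemma hypothesis_simps [simp]:
  "hypothesis qs (tick c s) = hypothesis qs s" "hypothesis qs (set_n a k s) = hypothesis qs s"
  by (simp_all add: hypothesis_def fun_eq_iff)

definition rounds_of :: "real \<Rightarrow> nat" where "rounds_of \<epsilon> = nat \<lfloor>16 / \<epsilon>\<^sup>2 + 2\<rfloor>"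

definition draws_of :: "nat \<Rightarrow> nat \<Rightarrow> real \<Rightarrow> nat" where
  "draws_of T q \<epsilon> = nat \<lfloor>real q * real T / \<epsilon> ^ 6\<rfloor>"

text \<open>Covers one drawn point with its prediction, loop tick included: 3 per coin,
  \<open>B\<close> for the sampler, and \<open>2 * B + 5\<close> for each of at most
  \<open>T\<close> queries in the sum for \<open>g\<close>.\<close>

definition predict_time :: "nat \<Rightarrow> nat \<Rightarrow> nat \<Rightarrow> nat" where
  "predict_time n T B = 3 * n + B + 9 + T * (2 * B + 5)"

definition refine_time :: "nat \<Rightarrow> nat \<Rightarrow> nat \<Rightarrow> nat \<Rightarrow> nat \<Rightarrow> real \<Rightarrow> nat" where
  "refine_time n T M q B \<epsilon> = 13 + M * (B + 5) + draws_of T q \<epsilon> * predict_time n T B"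

section \<open>Simulation of the abstract oracle for a fixed sample list\<close>

locale machine =
  fixes n T M q B :: nat and \<epsilon> :: real and X :: "'x set" and h :: "bool list \<Rightarrow> 'x"
    and th :: "bool list \<Rightarrow> nat" and tq :: "'x query \<Rightarrow> 'x \<times> int \<Rightarrow> nat" and S :: "('x \<times> int) list"
  assumes sampler: "valid_sampler n X h th B"
    and n: "1 \<le> n"
    and S: "length S = M" "set S \<subseteq> X \<times> {- 1, 1}"
begin

definition env_of :: "'x query list \<Rightarrow> 'x env" where
  "env_of qs = \<lparr>bits = n - 1, sampler = h, hcost = th, qcost = tq, samples = S, queries = qs\<rparr>"

lemma env_of_sel [simp]:
  "bits (env_of qs) = n - 1" "sampler (env_of qs) = h" "hcost (env_of qs) = th"
  "qcost (env_of qs) = tq" "samples (env_of qs) = S" "queries (env_of qs) = qs"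
  by (simp_all add: env_of_def)

definition inputs :: "'x state \<Rightarrow> bool" where
  "inputs s \<longleftrightarrow> nmem s 0 = n \<and> nmem s 1 = T \<and> nmem s 2 = M \<and> rmem s 0 = \<epsilon>"

abbreviation D :: "'x pmf" where "D \<equiv> sampler_dist n h"

abbreviation draws :: nat where "draws \<equiv> draws_of T q \<epsilon>"

lemma iter_sample_body:
  assumes "nmem s 5 = i" "drop i S = zs" "nmem s 3 < length qs"
    and "valid_query X tq B (qs ! nmem s 3)"
  shows "\<exists>s'. iter (env_of qs) sample_body (length zs) s = return_pmf s' \<and>
    rmem s' 2 = rmem s 2 + sum_list (map (qs ! nmem s 3) zs) \<and> agree {5, 6} {2, 3} s s' \<and>
    clock s' \<le> clock s + length zs * (B + 5)"
  using assms
proof (induction zs arbitrary: i s)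
  case Nil
  thus ?case by (simp add: agree_def)
next
  case (Cons z zs)
  obtain x y where z: "z = (x, y)" by (cases z)
  let ?\<phi> = "qs ! nmem s 3"
  have i: "i < length S" "S ! i = (x, y)" "drop (Suc i) S = zs"
    using Cons.prems(2) unfolding z
    by (metis drop_eq_Nil2 list.distinct(1) linorder_not_less,
        metis drop_eq_Nil2 hd_drop_conv_nth linorder_not_less list.distinct(1) list.sel(1),
        metis drop_Suc list.sel(3) tl_drop)
  have "(x, y) \<in> X \<times> {- 1, 1}" using i S(2) by (metis nth_mem subsetD)
  hence xy: "label_of (code_of y) = y" "tq ?\<phi> (x, y) \<le> B"
    using Cons.prems(4) by (auto simp: label_of_def code_of_def valid_query_def)
  define s1 where "s1 = tick 1 (set_n 5 (Suc i) (tick 1 (set_r 2 (rmem s 2 + ?\<phi> (x, y))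
    (tick (1 + tq ?\<phi> (x, y)) (set_r 3 (?\<phi> (x, y))
      (tick 1 (set_x 0 x (set_n 6 (code_of y) (tick 1 s)))))))))"
  have eq: "exec (env_of qs) sample_body (tick 1 s) = return_pmf s1"
    using i Cons.prems(1,3)
    by (simp add: sample_body_def bind_return_pmf xy s1_def Let_def)
  obtain s' where s': "iter (env_of qs) sample_body (length zs) s1 = return_pmf s'"
    "rmem s' 2 = rmem s1 2 + sum_list (map (qs ! nmem s1 3) zs)" "agree {5, 6} {2, 3} s1 s'"
    "clock s' \<le> clock s1 + length zs * (B + 5)"
    using Cons.IH[of s1 "Suc i"] Cons.prems i by (auto simp: s1_def)
  have "agree {5, 6} {2, 3} s s1" by (auto simp: agree_def s1_def)
  moreover have "clock s1 \<le> clock s + (B + 5)" using xy by (simp add: s1_def)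
  ultimately show ?case using s' eq agree_trans
    by (fastforce simp: bind_return_pmf s1_def z)
qed

lemma exec_sample_sum:
  assumes "inputs s" "nmem s 3 < length qs" "valid_query X tq B (qs ! nmem s 3)"
  shows "\<exists>s'. exec (env_of qs) sample_sum s = return_pmf s' \<and>
    rmem s' 2 = sum_list (map (qs ! nmem s 3) S) \<and> agree {5, 6} {2, 3} s s' \<and>
    clock s' \<le> clock s + (3 + M * (B + 5))"
proof -
  define s1 where "s1 = tick 1 (tick 1 (set_n 5 0 (tick 1 (set_r 2 0 s))))"
  obtain s' where s': "iter (env_of qs) sample_body (length S) s1 = return_pmf s'"
    "rmem s' 2 = rmem s1 2 + sum_list (map (qs ! nmem s1 3) S)" "agree {5, 6} {2, 3} s1 s'"
    "clock s' \<le> clock s1 + length S * (B + 5)"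
    using iter_sample_body[of s1 0 S qs] assms by (auto simp: s1_def)
  have "agree {5, 6} {2, 3} s s1" by (auto simp: agree_def s1_def)
  moreover have "exec (env_of qs) sample_sum s = return_pmf s'"
    using s'(1) assms(1) S by (simp add: sample_sum_def bind_return_pmf s1_def inputs_def)
  ultimately show ?thesis using s' S agree_trans by (fastforce simp: s1_def)
qed

text \<open>A coupling of the coin cells with a random bit list. The relation carries memory and
  clock along with the abstract value; framing the cells below the next coin keeps the earlier
  tosses.\<close>

lemma iter_coin_body:
  assumes "nmem s 7 = i"
  shows "rel_pmf (\<lambda>s' r. length r = k \<and> (\<forall>j<k. nmem s' (100 + i + j) = of_bool (r ! j)) \<and>
      (\<forall>a<100 + i. a \<noteq> 7 \<longrightarrow> nmem s' a = nmem s a) \<and> rmem s' = rmem s \<and> clock s' = clock s + 3 * k)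
    (iter E coin_body k s) (replicate_pmf k (pmf_of_set UNIV))"
  using assms
proof (induction k arbitrary: i s)
  case 0
  thus ?case by simp
next
  case (Suc k)
  define t where "t = (\<lambda>c. tick 1 (set_n 7 (Suc i) (tick 1 (set_n (100 + i) (of_bool c) (tick 1 s)))))"
  have eq: "exec E coin_body (tick 1 s) = map_pmf t (pmf_of_set UNIV)"
    using Suc.prems
    by (simp add: coin_body_def map_pmf_def bind_assoc_pmf bind_return_pmf t_def)
  have rep: "replicate_pmf (Suc k) (pmf_of_set (UNIV :: bool set)) =
      pmf_of_set UNIV \<bind> (\<lambda>c. map_pmf ((#) c) (replicate_pmf k (pmf_of_set UNIV)))"
    by (simp add: map_pmf_def)
  show ?case unfolding rep iter.simps eq
  proof (rule rel_pmf_bindI[where R = "\<lambda>s1 c. s1 = t c"])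
    show "rel_pmf (\<lambda>s1 c. s1 = t c) (map_pmf t (pmf_of_set UNIV)) (pmf_of_set UNIV)"
      by (simp add: pmf.rel_map rel_pmf_reflI)
  next
    fix s1 c assume s1: "s1 = t c"
    have "rel_pmf (\<lambda>s' r. length r = k \<and> (\<forall>j<k. nmem s' (100 + Suc i + j) = of_bool (r ! j)) \<and>
        (\<forall>a<100 + Suc i. a \<noteq> 7 \<longrightarrow> nmem s' a = nmem s1 a) \<and> rmem s' = rmem s1 \<and>
        clock s' = clock s1 + 3 * k)
      (iter E coin_body k s1) (replicate_pmf k (pmf_of_set UNIV))"
      by (rule Suc.IH) (simp add: s1 t_def)
    thus "rel_pmf (\<lambda>s' r. length r = Suc k \<and> (\<forall>j<Suc k. nmem s' (100 + i + j) = of_bool (r ! j)) \<and>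
        (\<forall>a<100 + i. a \<noteq> 7 \<longrightarrow> nmem s' a = nmem s a) \<and> rmem s' = rmem s \<and>
        clock s' = clock s + 3 * Suc k)
      (iter E coin_body k s1) (map_pmf ((#) c) (replicate_pmf k (pmf_of_set UNIV)))"
      unfolding pmf.rel_map
      by (rule rel_pmf_mono) (auto simp: s1 t_def less_Suc_eq_0_disj add.assoc)
  qed
qed

text \<open>The \<open>n - 1\<close> fair coins form a uniform bit string, so the point computed
  from them can be coupled with a draw from \<open>D\<close>.\<close>

lemma exec_draw:
  assumes "inputs s"
  shows "rel_pmf (\<lambda>s' x. x \<in> X \<and> xmem s' 1 = Some x \<and> agree ({7} \<union> {100..}) {} s s' \<and>
      clock s' \<le> clock s + (3 * n + B + 3))
    (exec (env_of qs) draw s) D"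
proof -
  define s1 where "s1 = tick 1 (tick 1 (set_n 7 0 s))"
  have n1: "nat \<lfloor>real n - 1\<rfloor> = n - 1"
    using n by (metis floor_of_nat nat_int of_nat_1 of_nat_diff)
  have eq: "exec (env_of qs) draw s = iter (env_of qs) coin_body (n - 1) s1
      \<bind> exec (env_of qs) (Sampler (num 1) (num 100))"
    using assms n n1 by (simp add: draw_def bind_return_pmf s1_def inputs_def of_nat_diff)
  have D: "D = replicate_pmf (n - 1) (pmf_of_set UNIV) \<bind> (\<lambda>r. return_pmf (h r))"
    by (simp add: sampler_dist_def replicate_pmf_coin map_pmf_def)
  show ?thesis unfolding eq D
  proof (rule rel_pmf_bindI[OF iter_coin_body[where i = 0]])
    show "nmem s1 7 = 0" by (simp add: s1_def)
  next
    fix s' :: "'x state" and r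
    assume *: "length r = n - 1 \<and> (\<forall>j<n - 1. nmem s' (100 + 0 + j) = of_bool (r ! j)) \<and>
      (\<forall>a<100 + 0. a \<noteq> 7 \<longrightarrow> nmem s' a = nmem s1 a) \<and> rmem s' = rmem s1 \<and>
      clock s' = clock s1 + 3 * (n - 1)"
    have r: "map (\<lambda>i. 0 < nmem s' (100 + i)) [0..<n - 1] = r"
      using * by (intro nth_equalityI) auto
    have "h r \<in> X" "th r \<le> B" using sampler * by (auto simp: valid_sampler_def)
    thus "rel_pmf (\<lambda>s' x. x \<in> X \<and> xmem s' 1 = Some x \<and> agree ({7} \<union> {100..}) {} s s' \<and>
        clock s' \<le> clock s + (3 * n + B + 3))
      (exec (env_of qs) (Sampler (num 1) (num 100)) s') (return_pmf (h r))"
      using * r n by (simp add: Let_def agree_def s1_def)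
  qed
qed

lemma iter_hyp_body:
  assumes "nmem s 8 = i" "drop i qs = ps" "xmem s 1 = Some x" "x \<in> X"
    and "\<forall>\<phi>\<in>set qs. valid_query X tq B \<phi>"
  shows "\<exists>s'. iter (env_of qs) hyp_body (length ps) s = return_pmf s' \<and>
    rmem s' 5 = rmem s 5 + (\<Sum>j=i..<length qs. rmem s (100 + j) * half_diff (qs ! j) x) \<and>
    (ps \<noteq> [] \<longrightarrow> rmem s' 6 = last ps (x, 1) \<and> rmem s' 7 = last ps (x, - 1)) \<and>
    agree {8} {5, 6, 7} s s' \<and> clock s' \<le> clock s + length ps * (2 * B + 5)"
  using assms(1-3)
proof (induction ps arbitrary: i s)
  case Nil
  thus ?case by (simp add: agree_def)
next
  case (Cons \<phi> ps)
  have i: "i < length qs" "qs ! i = \<phi>" "drop (Suc i) qs = ps"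
    using Cons.prems(2)
    by (metis drop_eq_Nil2 list.distinct(1) linorder_not_less,
        metis drop_eq_Nil2 hd_drop_conv_nth linorder_not_less list.distinct(1) list.sel(1),
        metis drop_Suc list.sel(3) tl_drop)
  have "valid_query X tq B \<phi>" using i assms(5) by auto
  hence tq: "tq \<phi> (x, 1) \<le> B" "tq \<phi> (x, - 1) \<le> B"
    using assms(4) by (auto simp: valid_query_def)
  define s1 where "s1 = tick 1 (set_n 8 (Suc i) (tick 1
    (set_r 5 (rmem s 5 + rmem s (100 + i) * half_diff \<phi> x)
      (tick (1 + tq \<phi> (x, - 1)) (set_r 7 (\<phi> (x, - 1))
        (tick (1 + tq \<phi> (x, 1)) (set_r 6 (\<phi> (x, 1)) (tick 1 s))))))))"
  have eq: "exec (env_of qs) hyp_body (tick 1 s) = return_pmf s1"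
    using i Cons.prems(1,3)
    by (simp add: hyp_body_def bind_return_pmf s1_def Let_def label_of_def half_diff_def)
  obtain s' where s': "iter (env_of qs) hyp_body (length ps) s1 = return_pmf s'"
    "rmem s' 5 = rmem s1 5 + (\<Sum>j=Suc i..<length qs. rmem s1 (100 + j) * half_diff (qs ! j) x)"
    "ps \<noteq> [] \<longrightarrow> rmem s' 6 = last ps (x, 1) \<and> rmem s' 7 = last ps (x, - 1)"
    "agree {8} {5, 6, 7} s1 s'" "clock s' \<le> clock s1 + length ps * (2 * B + 5)"
    using Cons.IH[of s1 "Suc i"] Cons.prems i by (auto simp: s1_def)
  have a: "agree {8} {5, 6, 7} s s1" by (auto simp: agree_def s1_def)
  have "rmem s' 5 = rmem s 5 + (\<Sum>j=i..<length qs. rmem s (100 + j) * half_diff (qs ! j) x)"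
    unfolding s'(2) using i by (simp add: s1_def sum.atLeast_Suc_lessThan)
  moreover have "rmem s' 6 = last (\<phi> # ps) (x, 1) \<and> rmem s' 7 = last (\<phi> # ps) (x, - 1)"
  proof (cases "ps = []")
    case True
    hence "s' = s1" using s'(1) by simp
    thus ?thesis using True by (simp add: s1_def)
  qed (use s' in simp)
  moreover have "clock s' \<le> clock s + length (\<phi> # ps) * (2 * B + 5)"
    using s'(5) tq by (simp add: s1_def)
  moreover have "iter (env_of qs) hyp_body (length (\<phi> # ps)) s = return_pmf s'"
    using s'(1) eq by (simp add: bind_return_pmf)
  ultimately show ?case using agree_trans[OF a s'(4)] by blast
qed

lemma exec_hyp_value:
  assumes "length qs = Suc (nmem s 3)" "xmem s 1 = Some x" "x \<in> X"
    and "\<forall>\<phi>\<in>set qs. valid_query X tq B \<phi>"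
  shows "\<exists>s'. exec (env_of qs) hyp_value s = return_pmf s' \<and>
    rmem s' 5 = hypothesis qs s x \<and> rmem s' 6 = last qs (x, 1) \<and> rmem s' 7 = last qs (x, - 1) \<and>
    agree {8} {5, 6, 7} s s' \<and> clock s' \<le> clock s + (3 + length qs * (2 * B + 5))"
proof -
  define s1 where "s1 = tick 1 (tick 1 (set_n 8 0 (tick 1 (set_r 5 0 s))))"
  have "qs \<noteq> []" using assms(1) by auto
  then obtain s' where s': "iter (env_of qs) hyp_body (length qs) s1 = return_pmf s'"
    "rmem s' 5 = rmem s1 5 + (\<Sum>j=0..<length qs. rmem s1 (100 + j) * half_diff (qs ! j) x)"
    "rmem s' 6 = last qs (x, 1)" "rmem s' 7 = last qs (x, - 1)"
    "agree {8} {5, 6, 7} s1 s'" "clock s' \<le> clock s1 + length qs * (2 * B + 5)"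
    using iter_hyp_body[of s1 0 qs qs x] assms by (auto simp: s1_def)
  have len: "nat \<lfloor>real (nmem s 3) + 1\<rfloor> = length qs"
    using assms(1) by (metis Suc_eq_plus1 floor_of_nat nat_int of_nat_1 of_nat_add)
  have "agree {8} {5, 6, 7} s s1" by (auto simp: agree_def s1_def)
  hence "agree {8} {5, 6, 7} s s'" using s'(5) by (rule agree_trans)
  moreover have "exec (env_of qs) hyp_value s = return_pmf s'"
    using s'(1) len by (simp add: hyp_value_def bind_return_pmf s1_def add.commute)
  moreover have "rmem s' 5 = hypothesis qs s x"
    using s'(2) by (simp add: s1_def hypothesis_def atLeast0LessThan)
  ultimately show ?thesis using s' by (auto simp: s1_def)
qed

abbreviation predict_cost :: nat where "predict_cost \<equiv> predict_time n T B"

abbreviation scratch :: "'x state \<Rightarrow> 'x state \<Rightarrow> bool" where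
  "scratch \<equiv> agree ({7, 8, 9} \<union> {100..}) {4, 5, 6, 7}"

text \<open>Once the point is drawn, the rest is deterministic. The spare unit in the clock bound
  pays for the tick of the surrounding loop.\<close>

lemma exec_predict_body:
  assumes "inputs s" "length qs = Suc (nmem s 3)" "length qs \<le> T"
    and "\<forall>\<phi>\<in>set qs. valid_query X tq B \<phi>"
  shows "rel_pmf (\<lambda>s' x. rmem s' 4 = rmem s 4 + predict (last qs) (hypothesis qs s) x \<and>
      nmem s' 9 = nmem s 9 + 1 \<and> scratch s s' \<and> clock s' + 1 \<le> clock s + predict_cost)
    (exec (env_of qs) predict_body s) D"
proof -
  have "rel_pmf (\<lambda>s' x. rmem s' 4 = rmem s 4 + predict (last qs) (hypothesis qs s) x \<and>
      nmem s' 9 = nmem s 9 + 1 \<and> scratch s s' \<and> clock s' + 1 \<le> clock s + predict_cost)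
    (exec (env_of qs) predict_body s) (D \<bind> return_pmf)"
    unfolding predict_body_def exec.simps(7)[of _ draw]
  proof (rule rel_pmf_bindI[OF exec_draw[OF assms(1)]], elim conjE)
    fix s1 x
    assume s1: "x \<in> X" "xmem s1 1 = Some x" "agree ({7} \<union> {100..}) {} s s1"
      "clock s1 \<le> clock s + (3 * n + B + 3)"
    obtain s2 where s2: "exec (env_of qs) hyp_value s1 = return_pmf s2"
      "rmem s2 5 = hypothesis qs s1 x" "rmem s2 6 = last qs (x, 1)" "rmem s2 7 = last qs (x, - 1)"
      "agree {8} {5, 6, 7} s1 s2" "clock s2 \<le> clock s1 + (3 + length qs * (2 * B + 5))"
      using exec_hyp_value[of qs s1 x] assms s1 agree_nmem[OF s1(3), of 3] by auto
    have "length qs * (2 * B + 5) \<le> T * (2 * B + 5)" using assms(3) by (rule mult_le_mono1)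
    hence clock: "clock s2 + 3 \<le> clock s + predict_cost"
      using s1(4) s2(6) unfolding predict_time_def by linarith
    have "hypothesis qs s1 = hypothesis qs s"
      using s1(3) by (simp add: fun_eq_iff hypothesis_def agree_def)
    moreover have "scratch s s2"
      using s1(3) s2(5) by (auto simp: agree_def)
    moreover have "rmem s2 4 = rmem s 4" "nmem s2 9 = nmem s 9"
      using s1(3) s2(5) by (auto simp: agree_def)
    ultimately show "rel_pmf (\<lambda>s' x. rmem s' 4 = rmem s 4 + predict (last qs) (hypothesis qs s) x \<and>
        nmem s' 9 = nmem s 9 + 1 \<and> scratch s s' \<and> clock s' + 1 \<le> clock s + predict_cost)
      (exec (env_of qs) (hyp_value ;; RStore (num 4) (RAdd (reg 4) (RDiv
       (RAdd (RMul (RAdd (RConst 1) (reg 5)) (reg 6)) (RMul (RSub (RConst 1) (reg 5)) (reg 7)))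
       (RConst 2))) ;; NStore (num 9) (NAdd (cell 9) (num 1))) s1) (return_pmf x)"
      using s2 clock by (auto simp: bind_return_pmf predict_def agree_def)
  qed
  thus ?thesis by (simp add: bind_return_pmf')
qed

lemma iter_predict_body:
  assumes "inputs s" "length qs = Suc (nmem s 3)" "length qs \<le> T"
    and "\<forall>\<phi>\<in>set qs. valid_query X tq B \<phi>"
  shows "rel_pmf (\<lambda>s' w. length w = k \<and>
      rmem s' 4 = rmem s 4 + sum_list (map (predict (last qs) (hypothesis qs s)) w) \<and>
      nmem s' 9 = nmem s 9 + k \<and> scratch s s' \<and> clock s' \<le> clock s + k * predict_cost)
    (iter (env_of qs) predict_body k s) (replicate_pmf k D)"
  using assms(1,2)
proof (induction k arbitrary: s)
  case 0
  show ?case by (simp add: agree_def)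
next
  case (Suc k)
  have rep: "replicate_pmf (Suc k) D = D \<bind> (\<lambda>x. map_pmf ((#) x) (replicate_pmf k D))"
    by (simp add: map_pmf_def)
  have "inputs (tick 1 s)" "length qs = Suc (nmem (tick 1 s) 3)"
    using Suc.prems by (simp_all add: inputs_def)
  note body = exec_predict_body[OF this assms(3,4)]
  show ?case unfolding rep iter.simps
  proof (rule rel_pmf_bindI[OF body], elim conjE)
    fix s1 x
    assume s1: "rmem s1 4 = rmem (tick 1 s) 4 + predict (last qs) (hypothesis qs (tick 1 s)) x"
      "nmem s1 9 = nmem (tick 1 s) 9 + 1" "scratch (tick 1 s) s1"
      "clock s1 + 1 \<le> clock (tick 1 s) + predict_cost"
    have a: "scratch s s1" using s1(3) by (simp add: agree_def)
    have hyp: "hypothesis qs (tick 1 s) = hypothesis qs s" "hypothesis qs s1 = hypothesis qs s"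
      using a by (auto simp: hypothesis_def agree_def)
    have "inputs s1" "length qs = Suc (nmem s1 3)"
      using Suc.prems a by (auto simp: inputs_def agree_def)
    from Suc.IH[OF this]
    show "rel_pmf (\<lambda>s' w. length w = Suc k \<and>
        rmem s' 4 = rmem s 4 + sum_list (map (predict (last qs) (hypothesis qs s)) w) \<and>
        nmem s' 9 = nmem s 9 + Suc k \<and> scratch s s' \<and> clock s' \<le> clock s + Suc k * predict_cost)
      (iter (env_of qs) predict_body k s1) (map_pmf ((#) x) (replicate_pmf k D))"
      unfolding pmf.rel_map
    proof (rule rel_pmf_mono, elim conjE, intro conjI)
      fix s' w assume "scratch s1 s'"
      thus "scratch s s'" using a agree_trans by blast
    qed (use s1 hyp in auto)
  qed
qed

lemma exec_predict_sum:
  assumes "inputs s" "length qs = Suc (nmem s 3)" "length qs \<le> T"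
    and "\<forall>\<phi>\<in>set qs. valid_query X tq B \<phi>"
  shows "rel_pmf (\<lambda>s' w. length w = draws \<and>
      rmem s' 4 = sum_list (map (predict (last qs) (hypothesis qs s)) w) \<and>
      nmem s' 9 = draws \<and> scratch s s' \<and> clock s' \<le> clock s + (3 + draws * predict_cost))
    (exec (env_of qs) (predict_sum q) s) (replicate_pmf draws D)"
proof -
  define s1 where "s1 = tick 1 (tick 1 (set_n 9 0 (tick 1 (set_r 4 0 s))))"
  have e6: "\<epsilon> * (\<epsilon> * \<epsilon>) * (\<epsilon> * (\<epsilon> * \<epsilon>)) = \<epsilon> ^ 6" by (simp add: power_numeral_reduce)
  have eq: "exec (env_of qs) (predict_sum q) s = iter (env_of qs) predict_body draws s1"
    using assms(1) e6 by (simp add: predict_sum_def bind_return_pmf s1_def inputs_def draws_of_def of_rat_of_nat_eq)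
  have a: "scratch s s1" by (auto simp: agree_def s1_def)
  have hyp: "hypothesis qs s1 = hypothesis qs s" by (simp add: fun_eq_iff hypothesis_def s1_def)
  have "inputs s1" "length qs = Suc (nmem s1 3)"
    using assms by (auto simp: inputs_def s1_def)
  from iter_predict_body[OF this assms(3,4)] show ?thesis unfolding eq
  proof (rule rel_pmf_mono, elim conjE, intro conjI)
    fix s' w assume "scratch s1 s'"
    thus "scratch s s'" using a agree_trans by blast
  qed (auto simp: hyp, auto simp: s1_def)
qed

text \<open>Coefficients of future queries are \<open>0\<close>, so that appending a new query to
  the list does not change the represented function.\<close>

definition represents :: "'x query list \<Rightarrow> 'x state \<Rightarrow> 'x hyp \<Rightarrow> bool" where
  "represents qs s gv \<longleftrightarrow> hypothesis qs s = fst gv \<and> rmem s 1 = snd gv \<and>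
     (\<forall>j\<ge>length qs. rmem s (100 + j) = 0)"

abbreviation refine_cost :: nat where "refine_cost \<equiv> refine_time n T M q B \<epsilon>"

lemma hypothesis_update:
  assumes "j < length qs"
    and "\<And>i. i < length qs \<Longrightarrow> rmem s' (100 + i) = rmem s (100 + i) + (if i = j then c else 0)"
  shows "hypothesis qs s' x = hypothesis qs s x + c * half_diff (qs ! j) x"
proof -
  have "hypothesis qs s' x = (\<Sum>i<length qs. rmem s (100 + i) * half_diff (qs ! i) x +
      (if i = j then c * half_diff (qs ! j) x else 0))"
    unfolding hypothesis_def using assms(2) by (intro sum.cong) (auto simp: algebra_simps)
  thus ?thesis using assms(1) by (simp add: sum.distrib hypothesis_def)
qed

text \<open>The fresh points are the only randomness of a round and are coupled by
  \<open>exec_predict_sum\<close>; given them, the machine and \<open>decide\<close> compare the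
  same two means and take the same branch.\<close>

lemma exec_refine_prog:
  assumes "inputs s" "length qs = Suc (nmem s 3)" "length qs \<le> T"
    and "\<forall>\<phi>\<in>set qs. valid_query X tq B \<phi>" and "represents qs s gv"
  shows "rel_pmf (\<lambda>s' gv'. represents qs s' gv' \<and> inputs s' \<and> nmem s' 3 = nmem s 3 \<and>
      clock s' + 1 \<le> clock s + refine_cost)
    (exec (env_of qs) (refine_prog q) s) (refine D draws (\<epsilon> / 4) S (last qs) gv)"
proof -
  let ?\<phi> = "last qs"
  have "qs \<noteq> []" using assms(2) by auto
  hence \<phi>: "qs ! nmem s 3 = ?\<phi>" using assms(2) by (simp add: last_conv_nth)
  have "valid_query X tq B ?\<phi>" using assms(4) \<open>qs \<noteq> []\<close> by simp
  then obtain s1 where s1: "exec (env_of qs) sample_sum s = return_pmf s1"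
    "rmem s1 2 = sum_list (map ?\<phi> S)" "agree {5, 6} {2, 3} s s1"
    "clock s1 \<le> clock s + (3 + M * (B + 5))"
    using exec_sample_sum[of s qs] assms(1,2) \<phi> by auto
  have hyp: "hypothesis qs s1 = fst gv"
    using assms(5) s1(3) by (auto simp: represents_def hypothesis_def agree_def fun_eq_iff)
  have s1': "inputs s1" "length qs = Suc (nmem s1 3)"
    using assms s1(3) by (auto simp: inputs_def agree_def)
  have eq: "exec (env_of qs) (refine_prog q) s = exec (env_of qs) (predict_sum q) s1 \<bind>
      exec (env_of qs) (RStore (num 2) (RDiv (reg 2) (OfNat (cell 2))) ;;
        RStore (num 4) (RDiv (reg 4) (OfNat (cell 9))) ;; decide_prog)"
    unfolding refine_prog_def exec.simps(7)[of _ sample_sum] exec.simps(7)[of _ "predict_sum q"] s1(1)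
    by (simp add: bind_return_pmf)
  show ?thesis unfolding eq refine_def map_pmf_def
  proof (rule rel_pmf_bindI[OF exec_predict_sum[OF s1' assms(3,4)]], elim conjE)
    fix s2 w
    assume s2: "length w = draws"
      "rmem s2 4 = sum_list (map (predict ?\<phi> (hypothesis qs s1)) w)" "nmem s2 9 = draws"
      "scratch s1 s2" "clock s2 \<le> clock s1 + (3 + draws * predict_cost)"
    let ?p = "mean ?\<phi> S" and ?e = "mean (predict ?\<phi> (fst gv)) w"
    have mem: "rmem s2 2 = rmem s1 2" "nmem s2 3 = nmem s 3" "rmem s2 0 = \<epsilon>" "nmem s2 2 = M"
      "rmem s2 1 = snd gv" "\<And>j. rmem s2 (100 + j) = rmem s (100 + j)" "nmem s2 0 = n" "nmem s2 1 = T"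
      using s1(3) s2(4) assms(1,5) by (auto simp: agree_def inputs_def represents_def)
    define s3 where "s3 = tick 1 (set_r 4 ?e (tick 1 (set_r 2 ?p s2)))"
    have s3: "exec (env_of qs) (RStore (num 2) (RDiv (reg 2) (OfNat (cell 2))) ;;
        RStore (num 4) (RDiv (reg 4) (OfNat (cell 9))) ;; decide_prog) s2
      = exec (env_of qs) decide_prog s3"
      using s1(2) s2 S mem by (simp add: bind_return_pmf s3_def mean_def hyp)
    define s4 where "s4 = (if ?p - ?e \<le> 3 * (\<epsilon> / 4) then
        if ?e - ?p \<le> 3 * (\<epsilon> / 4) then tick 1 (set_r 1 ?e (tick 1 (tick 1 s3)))
        else tick 1 (set_r (100 + nmem s 3) (rmem s (100 + nmem s 3) - \<epsilon> / 4) (tick 1 (tick 1 s3)))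
      else tick 1 (set_r (100 + nmem s 3) (rmem s (100 + nmem s 3) + \<epsilon> / 4) (tick 1 s3)))"
    have s4: "exec (env_of qs) decide_prog s3 = return_pmf s4"
      using mem by (simp add: decide_prog_def s3_def s4_def)
    have "clock s4 + 1 \<le> clock s + refine_cost"
      using s1(4) s2(5) by (auto simp: refine_time_def s4_def s3_def)
    moreover have "inputs s4" "nmem s4 3 = nmem s 3"
      using mem by (auto simp: inputs_def s4_def s3_def)
    moreover have "represents qs s4 (decide (\<epsilon> / 4) ?\<phi> ?p ?e gv)"
    proof -
      have hs: "hypothesis qs s = fst gv" using assms(5) by (simp add: represents_def)
      have 0: "\<forall>j\<ge>length qs. rmem s4 (100 + j) = 0"
        using assms(2,5) mem(6) by (auto simp: represents_def s4_def s3_def)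
      \<comment> \<open>The change of the current coefficient in the three branches, equal to the
        multiple of \<open>half_diff\<close> that \<open>decide\<close> adds.\<close>
      define c where "c = (if ?p - ?e \<le> 3 * (\<epsilon> / 4) then
        if ?e - ?p \<le> 3 * (\<epsilon> / 4) then 0 else - (\<epsilon> / 4) else \<epsilon> / 4)"
      have "rmem s4 (100 + i) = rmem s (100 + i) + (if i = nmem s 3 then c else 0)" for i
        using mem(6) by (auto simp: s4_def s3_def c_def)
      hence "hypothesis qs s4 x = fst gv x + c * half_diff ?\<phi> x" for x
        using hypothesis_update[of "nmem s 3" qs s4 s c x] assms(2) by (simp add: hs \<phi>)
      hence "hypothesis qs s4 = fst (decide (\<epsilon> / 4) ?\<phi> ?p ?e gv)"
        by (auto simp: fun_eq_iff decide_def c_def)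
      moreover have "rmem s4 1 = snd (decide (\<epsilon> / 4) ?\<phi> ?p ?e gv)"
        using mem(5) by (simp add: s4_def s3_def decide_def)
      ultimately show ?thesis using 0 by (simp add: represents_def)
    qed
    ultimately show "rel_pmf (\<lambda>s' gv'. represents qs s' gv' \<and> inputs s' \<and> nmem s' 3 = nmem s 3 \<and>
        clock s' + 1 \<le> clock s + refine_cost)
      (exec (env_of qs) (RStore (num 2) (RDiv (reg 2) (OfNat (cell 2))) ;;
        RStore (num 4) (RDiv (reg 4) (OfNat (cell 9))) ;; decide_prog) s2)
      (return_pmf (decide (\<epsilon> / 4) ?\<phi> ?p ?e gv))"
      unfolding s3 s4 by simp
  qed
qed

lemma iter_refine_prog:
  assumes "inputs s" "length qs = Suc (nmem s 3)" "length qs \<le> T"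
    and "\<forall>\<phi>\<in>set qs. valid_query X tq B \<phi>" and "represents qs s gv"
  shows "rel_pmf (\<lambda>s' gv'. represents qs s' gv' \<and> inputs s' \<and> clock s' \<le> clock s + k * refine_cost)
    (iter (env_of qs) (refine_prog q) k s) (refines D draws (\<epsilon> / 4) S (last qs) k gv)"
  using assms(1,2,5)
proof (induction k arbitrary: s gv)
  case 0
  thus ?case by simp
next
  case (Suc k)
  have "inputs (tick 1 s)" "length qs = Suc (nmem (tick 1 s) 3)" "represents qs (tick 1 s) gv"
    using Suc.prems by (simp_all add: inputs_def represents_def)
  note body = exec_refine_prog[OF this(1,2) assms(3,4) this(3)]
  show ?case unfolding iter.simps refines.simps
  proof (rule rel_pmf_bindI[OF body], elim conjE)
    fix s1 gv1
    assume s1: "represents qs s1 gv1" "inputs s1" "nmem s1 3 = nmem (tick 1 s) 3"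
      "clock s1 + 1 \<le> clock (tick 1 s) + refine_cost"
    hence "length qs = Suc (nmem s1 3)" using Suc.prems by simp
    from Suc.IH[OF s1(2) this s1(1)]
    show "rel_pmf (\<lambda>s' gv'. represents qs s' gv' \<and> inputs s' \<and> clock s' \<le> clock s + Suc k * refine_cost)
      (iter (env_of qs) (refine_prog q) k s1) (refines D draws (\<epsilon> / 4) S (last qs) k gv1)"
      by (rule rel_pmf_mono) (use s1(4) in auto)
  qed
qed

abbreviation rounds :: nat where "rounds \<equiv> rounds_of \<epsilon>"

lemma exec_oracle_prog:
  assumes "inputs s" "length qs = Suc (nmem s 3)" "length qs \<le> T"
    and "\<forall>\<phi>\<in>set qs. valid_query X tq B \<phi>" and "represents qs s gv"
  shows "rel_pmf (\<lambda>s' gv'. represents qs s' gv' \<and> inputs s' \<and>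
      clock s' \<le> clock s + (1 + rounds * refine_cost))
    (exec (env_of qs) (oracle_prog q) s) (refines D draws (\<epsilon> / 4) S (last qs) rounds gv)"
proof -
  have eq: "exec (env_of qs) (oracle_prog q) s = iter (env_of qs) (refine_prog q) rounds (tick 1 s)"
    using assms(1) by (simp add: oracle_prog_def rounds_of_def inputs_def power2_eq_square)
  have "inputs (tick 1 s)" "length qs = Suc (nmem (tick 1 s) 3)" "represents qs (tick 1 s) gv"
    using assms by (simp_all add: inputs_def represents_def)
  from iter_refine_prog[OF this(1,2) assms(3,4) this(3)] show ?thesis
    unfolding eq by (rule rel_pmf_mono) auto
qed

text \<open>Machine and abstract process show the analyst equal histories, so its queries can be
  coupled to coincide; the answer in real cell 1 is the second component of the abstract
  pair.\<close>

lemma interact_oracle_prog: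
  assumes A: "valid_analyst X tq B A"
    and "inputs s" "length H + k = T"
    and "\<forall>\<phi>\<in>fst ` set H. valid_query X tq B \<phi>" "represents (map fst H) s gv"
  shows "rel_pmf (\<lambda>(H', s') H''. H' = H'' \<and> clock s' \<le> clock s + k * (1 + rounds * refine_cost))
    (interact (oracle_prog q) (env_of []) A k H s)
    (transcript D draws (\<epsilon> / 4) rounds A S k H gv)"
  using assms(2-)
proof (induction k arbitrary: H s gv)
  case 0
  thus ?case by simp
next
  case (Suc k)
  let ?R = "\<lambda>(H', s') H''. H' = H'' \<and> clock s' \<le> clock s + Suc k * (1 + rounds * refine_cost)"
  show ?case unfolding interact.simps transcript.simps
  proof (rule rel_pmf_bindI[where R = "\<lambda>\<phi> \<psi>. \<phi> = \<psi> \<and> \<phi> \<in> set_pmf (A H)"])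
    show "rel_pmf (\<lambda>\<phi> \<psi>. \<phi> = \<psi> \<and> \<phi> \<in> set_pmf (A H)) (A H) (A H)"
      by (rule rel_pmf_reflI) simp
  next
    fix \<phi> \<psi> assume *: "\<phi> = \<psi> \<and> \<phi> \<in> set_pmf (A H)"
    hence [simp]: "\<psi> = \<phi>" and \<phi>: "valid_query X tq B \<phi>" using A by (auto simp: valid_analyst_def)
    let ?qs = "map fst H @ [\<phi>]" and ?s = "set_n 3 (length H) s"
    have qs: "length ?qs = Suc (nmem ?s 3)" "length ?qs \<le> T" "\<forall>\<phi>\<in>set ?qs. valid_query X tq B \<phi>"
      using Suc.prems \<phi> by auto
    have "inputs ?s" using Suc.prems by (simp add: inputs_def)
    moreover have "represents ?qs ?s gv"
    proof -
      have zero: "rmem s (100 + length H) = 0" using Suc.prems(4) by (simp add: represents_def)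
      have "hypothesis ?qs ?s x = hypothesis (map fst H) s x" for x
        using zero by (simp add: hypothesis_def nth_append)
      thus ?thesis using Suc.prems(4) by (auto simp: represents_def)
    qed
    ultimately have "rel_pmf (\<lambda>s' gv'. represents ?qs s' gv' \<and> inputs s' \<and>
        clock s' \<le> clock ?s + (1 + rounds * refine_cost))
      (exec (env_of ?qs) (oracle_prog q) ?s) (refines D draws (\<epsilon> / 4) S (last ?qs) rounds gv)"
      using qs by (intro exec_oracle_prog)
    moreover have env: "env_of []\<lparr>queries := ?qs\<rparr> = env_of ?qs" by (simp add: env_of_def)
    ultimately have step: "rel_pmf (\<lambda>s' gv'. represents ?qs s' gv' \<and> inputs s' \<and>
        clock s' \<le> clock s + (1 + rounds * refine_cost))
      (exec (env_of []\<lparr>queries := ?qs\<rparr>) (oracle_prog q) ?s)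
      (refines D draws (\<epsilon> / 4) S \<psi> rounds gv)" unfolding env by simp
    show "rel_pmf ?R
      (exec (env_of []\<lparr>queries := ?qs\<rparr>) (oracle_prog q) ?s \<bind>
         (\<lambda>s'. interact (oracle_prog q) (env_of []) A k (H @ [(\<phi>, rmem s' 1)]) s'))
      (refines D draws (\<epsilon> / 4) S \<psi> rounds gv \<bind>
         (\<lambda>gv'. transcript D draws (\<epsilon> / 4) rounds A S k (H @ [(\<psi>, snd gv')]) gv'))"
    proof (rule rel_pmf_bindI[OF step], elim conjE)
      fix s' gv' assume s': "represents ?qs s' gv'" "inputs s'"
        "clock s' \<le> clock s + (1 + rounds * refine_cost)"
      have v: "rmem s' 1 = snd gv'" using s' by (simp add: represents_def)
      have "rel_pmf (\<lambda>(H', s'') H''. H' = H'' \<and> clock s'' \<le> clock s' + k * (1 + rounds * refine_cost))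
        (interact (oracle_prog q) (env_of []) A k (H @ [(\<phi>, snd gv')]) s')
        (transcript D draws (\<epsilon> / 4) rounds A S k (H @ [(\<phi>, snd gv')]) gv')"
        using Suc.prems s' \<phi> by (intro Suc.IH) auto
      thus "rel_pmf ?R (interact (oracle_prog q) (env_of []) A k (H @ [(\<phi>, rmem s' 1)]) s')
         (transcript D draws (\<epsilon> / 4) rounds A S k (H @ [(\<psi>, snd gv')]) gv')"
        unfolding v \<open>\<psi> = \<phi>\<close> by (rule rel_pmf_mono) (use s'(3) in auto)
    qed
  qed
qed

end

section \<open>Sample size and running time\<close>

text \<open>This is \<open>1 / \<eta>\<^sup>2\<close> rounded up, for
  \<open>\<eta> = \<epsilon> / 4\<close>: the potential starts at \<open>1\<close> and drops by
  \<open>\<eta>\<^sup>2\<close> per update.\<close>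

definition budget :: "real \<Rightarrow> nat" where "budget \<epsilon> = nat \<lceil>16 / \<epsilon>\<^sup>2\<rceil>"

text \<open>Solves \<open>2 * exp (- M * \<epsilon>\<^sup>2 / 32) * leaves (T * rounds_of
  \<epsilon>) (budget \<epsilon>) \<le> \<delta> / 2\<close> for the number \<open>M\<close> of
  samples.\<close>

definition sample_size :: "real \<Rightarrow> real \<Rightarrow> nat \<Rightarrow> nat" where
  "sample_size \<delta> \<epsilon> T = nat \<lceil>32 / \<epsilon>\<^sup>2 * (ln (4 / \<delta>) +
     real (budget \<epsilon> + 1) * ln (real (2 * (T * rounds_of \<epsilon>) + 1)))\<rceil>"

text \<open>The constant is \<open>2 * 36 * 1152\<close>, read off from the end of
  \<open>estimate_failure_le\<close>; the summand \<open>1\<close> makes up for the rounding down in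
  \<open>draws_of\<close>.\<close>

definition draw_factor :: "real \<Rightarrow> nat" where "draw_factor \<delta> = nat \<lceil>82944 / \<delta>\<rceil> + 1"

text \<open>The summand \<open>33\<close> absorbs the rounding up,
  \<open>32 * ln (4 / \<delta>)\<close> is the price of confidence, and \<open>32 * 18 * 39\<close>
  that of the union bound.\<close>

definition size_const :: "real \<Rightarrow> real" where "size_const \<delta> = 33 + 32 * ln (4 / \<delta>) + 32 * 18 * 39"

section \<open>Numerical estimates\<close>

context
  fixes \<epsilon> \<delta> :: real and T :: nat
  assumes eps: "0 < \<epsilon>" "\<epsilon> < 1" and T: "1 \<le> T" and del: "0 < \<delta>" "\<delta> < 1"
begin

lemma inv_eps: "1 \<le> 1 / \<epsilon>" "1 \<le> 1 / \<epsilon> ^ k" for k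
  using eps by (simp_all add: power_le_one)

lemma budget_ge: "16 / \<epsilon>\<^sup>2 \<le> real (budget \<epsilon>)"
  unfolding budget_def by linarith

lemma budget_le: "real (budget \<epsilon>) \<le> 17 / \<epsilon>\<^sup>2"
proof -
  have "real (budget \<epsilon>) \<le> 16 / \<epsilon>\<^sup>2 + 1" using inv_eps(2)[of 2] unfolding budget_def by linarith
  thus ?thesis using inv_eps(2)[of 2] by (simp add: field_simps)
qed

lemma rounds_le: "real (rounds_of \<epsilon>) \<le> 18 / \<epsilon>\<^sup>2"
proof -
  have "real (rounds_of \<epsilon>) \<le> 16 / \<epsilon>\<^sup>2 + 2"
    using inv_eps(2)[of 2] unfolding rounds_of_def by linarith
  thus ?thesis using inv_eps(2)[of 2] by (simp add: field_simps)
qed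

lemma budget_less_rounds: "budget \<epsilon> < rounds_of \<epsilon>"
  using inv_eps(2)[of 2] unfolding rounds_of_def budget_def by linarith

lemma sample_size_pos: "0 < sample_size \<delta> \<epsilon> T"
proof -
  have "0 < ln (4 / \<delta>)" using del by simp
  moreover have "0 \<le> real (budget \<epsilon> + 1) * ln (real (2 * (T * rounds_of \<epsilon>) + 1))" by simp
  ultimately have "0 < 32 / \<epsilon>\<^sup>2 * (ln (4 / \<delta>) +
     real (budget \<epsilon> + 1) * ln (real (2 * (T * rounds_of \<epsilon>) + 1)))"
    using eps by (intro mult_pos_pos add_pos_nonneg) auto
  thus ?thesis unfolding sample_size_def by linarith
qed

text \<open>Hoeffding's inequality contributes one factor \<open>1 / \<epsilon>\<^sup>2\<close> and
  the number of updates, in the exponent of \<open>leaves\<close>, the other. The logarithm of the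
  number of rounds costs a constant times the clipped logarithm.\<close>

lemma sample_size_le: "real (sample_size \<delta> \<epsilon> T) \<le> size_const \<delta> * sample_rate \<epsilon> T"
proof -
  define r where "r = max 1 (ln (real T / \<epsilon>))"
  define i where "i = 1 / \<epsilon>\<^sup>2"
  define W where "W = real (2 * (T * rounds_of \<epsilon>) + 1)"
  have r: "1 \<le> r" "ln (real T / \<epsilon>) \<le> r" by (simp_all add: r_def)
  have i: "1 \<le> i" using inv_eps(2)[of 2] by (simp add: i_def)
  have ln4: "0 \<le> ln (4 / \<delta>)" using del by simp
  have rate: "sample_rate \<epsilon> T = i * i * r"
    by (simp add: sample_rate_def r_def i_def power_numeral_reduce)
  have x: "1 \<le> real T / \<epsilon>" using T eps by (simp add: le_divide_eq)
  \<comment> \<open>Here \<open>37 = 2 * 18 + 1\<close>; enlarging \<open>T\<close> to its square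
    leaves a pure power of \<open>T / \<epsilon>\<close>.\<close>
  have "W \<le> 37 * (real T / \<epsilon>)\<^sup>2"
  proof -
    have "real T * real (rounds_of \<epsilon>) \<le> real T * (18 / \<epsilon>\<^sup>2)"
      using rounds_le by (intro mult_left_mono) auto
    also have "\<dots> \<le> (real T)\<^sup>2 * (18 / \<epsilon>\<^sup>2)"
      using T by (intro mult_right_mono) (auto simp: power2_eq_square)
    finally have "real T * real (rounds_of \<epsilon>) \<le> 18 * (real T / \<epsilon>)\<^sup>2"
      by (simp add: power_divide mult.commute)
    moreover have "1 \<le> (real T / \<epsilon>)\<^sup>2" using x by (rule one_le_power)
    ultimately show ?thesis unfolding W_def by simp
  qed
  moreover have W1: "1 \<le> W" by (simp add: W_def)
  ultimately have "ln W \<le> ln (37 * (real T / \<epsilon>)\<^sup>2)" by (intro ln_mono) auto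
  also have "\<dots> = ln 37 + 2 * ln (real T / \<epsilon>)"
    using T eps by (subst ln_mult) (auto simp: ln_realpow)
  also have "\<dots> \<le> 37 + 2 * r" using r ln_le_minus_one[of 37] by simp
  \<comment> \<open>The clipping of the logarithm at \<open>1\<close> absorbs the constant.\<close>
  also have "\<dots> \<le> 39 * r" using r by simp
  finally have lnW: "ln W \<le> 39 * r" .
  have K: "real (budget \<epsilon> + 1) \<le> 18 * i"
    using budget_le i by (simp add: i_def)
  have "0 \<le> ln W" using W1 by simp
  hence KW: "real (budget \<epsilon> + 1) * ln W \<le> (18 * i) * (39 * r)"
    using K lnW i by (intro mult_mono) auto
  have ir: "1 \<le> i * r" using i r mult_mono[of 1 i 1 r] by simp
  have iir: "1 \<le> i * i * r" using i ir mult_mono[of 1 i 1 "i * r"] by (simp add: mult.assoc)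
  have "32 * i * (ln (4 / \<delta>) + real (budget \<epsilon> + 1) * ln W) \<le>
      32 * i * (ln (4 / \<delta>) * (i * r) + (18 * i) * (39 * r))"
    using i KW mult_left_mono[OF ir ln4] by (intro mult_left_mono add_mono) auto
  also have "\<dots> = (32 * ln (4 / \<delta>) + 32 * 18 * 39) * (i * i * r)" by (simp add: algebra_simps)
  finally have *: "32 * i * (ln (4 / \<delta>) + real (budget \<epsilon> + 1) * ln W) \<le> \<dots>" .
  have eq: "sample_size \<delta> \<epsilon> T = nat \<lceil>32 * i * (ln (4 / \<delta>) + real (budget \<epsilon> + 1) * ln W)\<rceil>"
    by (simp add: sample_size_def i_def W_def)
  have "0 \<le> 32 * i * (ln (4 / \<delta>) + real (budget \<epsilon> + 1) * ln W)"
    using i ln4 \<open>0 \<le> ln W\<close> by simp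
  hence "real (sample_size \<delta> \<epsilon> T) \<le> 32 * i * (ln (4 / \<delta>) + real (budget \<epsilon> + 1) * ln W) + 1"
    unfolding eq by linarith
  also have "\<dots> \<le> (32 * ln (4 / \<delta>) + 32 * 18 * 39) * (i * i * r) + 33 * (i * i * r)"
    using * iir by linarith
  also have "\<dots> = size_const \<delta> * sample_rate \<epsilon> T"
    by (simp add: size_const_def rate algebra_simps)
  finally show ?thesis .
qed

text \<open>The sample size was solved from this inequality: \<open>exp (- Y)\<close> is exactly
  \<open>\<delta> / 4\<close> divided by the value of \<open>leaves\<close>. The factor
  \<open>1\<^sup>2\<close> stands for the range of a query.\<close>

lemma sample_failure_le:
  "2 * exp (- (real (sample_size \<delta> \<epsilon> T) * (\<epsilon> / 4)\<^sup>2 / (2 * 1\<^sup>2))) *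
     real (leaves (T * rounds_of \<epsilon>) (budget \<epsilon>)) \<le> \<delta> / 2"
proof -
  define W where "W = real (2 * (T * rounds_of \<epsilon>) + 1)"
  define Y where "Y = ln (4 / \<delta>) + real (budget \<epsilon> + 1) * ln W"
  have W: "0 < W" unfolding W_def by (simp add: add_pos_nonneg)
  have "32 / \<epsilon>\<^sup>2 * Y \<le> real (sample_size \<delta> \<epsilon> T)"
    unfolding sample_size_def Y_def W_def by linarith
  hence "Y \<le> real (sample_size \<delta> \<epsilon> T) * (\<epsilon> / 4)\<^sup>2 / (2 * 1\<^sup>2)"
    using eps by (simp add: field_simps)
  hence "exp (- (real (sample_size \<delta> \<epsilon> T) * (\<epsilon> / 4)\<^sup>2 / (2 * 1\<^sup>2))) \<le> exp (- Y)" by simp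
  also have "exp (- Y) = \<delta> / 4 / W ^ (budget \<epsilon> + 1)"
  proof -
    have "exp (real (budget \<epsilon> + 1) * ln W) = W ^ (budget \<epsilon> + 1)"
      using W by (subst exp_of_nat_mult) simp
    hence "exp Y = 4 / \<delta> * W ^ (budget \<epsilon> + 1)" using del by (simp only: Y_def exp_add) simp
    thus ?thesis by (simp add: exp_minus)
  qed
  finally have "exp (- (real (sample_size \<delta> \<epsilon> T) * (\<epsilon> / 4)\<^sup>2 / (2 * 1\<^sup>2))) * W ^ (budget \<epsilon> + 1)
      \<le> \<delta> / 4"
    using W by (simp add: pos_le_divide_eq)
  moreover have "real (leaves (T * rounds_of \<epsilon>) (budget \<epsilon>)) = W ^ (budget \<epsilon> + 1)"
    unfolding leaves_def W_def of_nat_power ..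
  ultimately show ?thesis by simp
qed

abbreviation "draw_count \<equiv> draws_of T (draw_factor \<delta>) \<epsilon>"

lemma draws_ge: "(82944 / \<delta>) * (real T / \<epsilon> ^ 6) \<le> real draw_count"
proof -
  have "1 \<le> real T / \<epsilon> ^ 6" using T eps by (simp add: le_divide_eq power_le_one order_trans[of _ 1])
  moreover have "(82944 / \<delta> + 1) * (real T / \<epsilon> ^ 6) \<le> real (draw_factor \<delta>) * (real T / \<epsilon> ^ 6)"
    unfolding draw_factor_def using eps by (intro mult_right_mono) (linarith, simp)
  ultimately have "82944 / \<delta> * (real T / \<epsilon> ^ 6) \<le> real (draw_factor \<delta>) * (real T / \<epsilon> ^ 6) - 1"
    unfolding distrib_right by linarith
  thus ?thesis unfolding draws_of_def times_divide_eq_right by linarith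
qed

lemma draws_pos: "0 < draw_count"
proof -
  have "0 < (82944 / \<delta>) * (real T / \<epsilon> ^ 6)" using T eps del by simp
  thus ?thesis using draws_ge by linarith
qed

text \<open>The hypothesis may grow to \<open>budget \<epsilon> * \<epsilon> / 4\<close>, which
  bounds predictions by \<open>6 / \<epsilon>\<close>. The crude estimate
  \<open>exp (- x) \<le> 1 / x\<close> suffices, because the number of fresh points only has to be
  polynomial.\<close>

lemma estimate_failure_le:
  "real (T * rounds_of \<epsilon>) *
     (2 * exp (- (real draw_count * (\<epsilon> / 4)\<^sup>2 / (2 * (1 + real (budget \<epsilon>) * (\<epsilon> / 4))\<^sup>2)))) \<le> \<delta> / 2"
proof -
  define c where "c = 1 + real (budget \<epsilon>) * (\<epsilon> / 4)"
  define x where "x = real draw_count * (\<epsilon> / 4)\<^sup>2 / (2 * c\<^sup>2)"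
  have c1: "1 \<le> c" using eps by (simp add: c_def)
  have "real (budget \<epsilon>) * (\<epsilon> / 4) \<le> 17 / \<epsilon>\<^sup>2 * (\<epsilon> / 4)"
    using budget_le eps by (intro mult_right_mono) auto
  also have "\<dots> = 17 / 4 * (1 / \<epsilon>)" using eps by (simp add: power2_eq_square)
  finally have "c \<le> 6 * (1 / \<epsilon>)" using inv_eps(1) unfolding c_def by linarith
  hence "c\<^sup>2 \<le> (6 * (1 / \<epsilon>))\<^sup>2" using c1 by (intro power_mono) auto
  hence c2: "c\<^sup>2 \<le> 36 / \<epsilon>\<^sup>2" by (simp add: power_divide)
  have x: "0 < x" using draws_pos eps c1 by (simp add: x_def)
  have "exp (- x) \<le> 1 / x"
  proof -
    have "x \<le> exp x" using exp_ge_add_one_self[of x] by linarith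
    thus ?thesis using x by (simp add: exp_minus inverse_eq_divide frac_le)
  qed
  also have "1 / x = 32 * c\<^sup>2 / (real draw_count * \<epsilon>\<^sup>2)"
    using draws_pos eps c1 by (simp add: x_def field_simps)
  also have "\<dots> \<le> 32 * (36 / \<epsilon>\<^sup>2) / (real draw_count * \<epsilon>\<^sup>2)"
    using c2 by (intro divide_right_mono mult_left_mono) auto
  also have "\<dots> = 1152 / (real draw_count * \<epsilon> ^ 4)"
    using eps by (simp add: field_simps power_numeral_reduce)
  finally have e: "exp (- x) \<le> 1152 / (real draw_count * \<epsilon> ^ 4)" .
  have "real (T * rounds_of \<epsilon>) * (2 * exp (- x)) \<le>
      (real T * (18 / \<epsilon>\<^sup>2)) * (2 * (1152 / (real draw_count * \<epsilon> ^ 4)))"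
    unfolding of_nat_mult using e rounds_le eps
    by (intro mult_mono) auto
  also have "\<dots> = 41472 * (real T / \<epsilon> ^ 6) / real draw_count"
    using eps by (simp add: field_simps power_numeral_reduce)
  also have "\<dots> \<le> \<delta> / 2"
  proof -
    have "41472 * (real T / \<epsilon> ^ 6) \<le> \<delta> / 2 * real draw_count"
      using mult_left_mono[OF draws_ge, of "\<delta> / 2"] del by (simp add: field_simps)
    moreover have "0 < real draw_count" using draws_pos by simp
    ultimately show ?thesis by (subst pos_divide_le_eq) simp_all
  qed
  finally show ?thesis by (simp add: x_def c_def)
qed

lemma size_const_nonneg: "0 \<le> size_const \<delta>"
  using del by (simp add: size_const_def)

text \<open>Every quantity is bounded by a power of \<open>Z = n + 1 / \<epsilon> + T\<close>, and
  the exponents add up: \<open>1\<close> for the queries, \<open>2\<close> for the rounds,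
  \<open>7\<close> for the fresh points and \<open>k + 1\<close> for a prediction.\<close>

lemma runtime_le:
  assumes n: "1 \<le> n"
  shows "real (T * (1 + rounds_of \<epsilon> *
      refine_time n T (sample_size \<delta> \<epsilon> T) (draw_factor \<delta>) (a * n ^ k) \<epsilon>))
    \<le> (1 + 18 * (13 + size_const \<delta> * (real a + 5) + real (draw_factor \<delta>) * (3 * real a + 17)))
      * (real n + 1 / \<epsilon> + real T) ^ (k + 11)"
proof -
  define Z where "Z = real n + 1 / \<epsilon> + real T"
  define B where "B = a * n ^ k"
  define C q where "C = size_const \<delta>" and "q = real (draw_factor \<delta>)"
  let ?M = "sample_size \<delta> \<epsilon> T" and ?L = "rounds_of \<epsilon>"
  have Z: "1 \<le> Z" "real n \<le> Z" "real T \<le> Z" "1 / \<epsilon> \<le> Z"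
    using inv_eps(1) n T by (simp_all add: Z_def)
  note Zp = power_increasing[OF _ Z(1)] one_le_power[OF Z(1)]
  have C: "0 \<le> C" "0 \<le> q" by (simp_all add: C_def q_def size_const_nonneg)
  have eZ: "1 / \<epsilon> ^ j \<le> Z ^ j" for j
    using power_mono[OF Z(4), of j] eps by (simp add: power_divide)
  have B: "real B \<le> real a * Z ^ k"
    unfolding B_def using power_mono[OF Z(2), of k] by (simp add: mult_left_mono)
  have B5: "real B + 5 \<le> (real a + 5) * Z ^ k"
    using B Zp(2)[of k] by (simp add: algebra_simps)
  \<comment> \<open>The logarithm is bounded by its argument, and
    \<open>T / \<epsilon> \<le> Z * Z\<close>.\<close>
  have M: "real ?M \<le> C * Z ^ 6"
  proof -
    have "real T / \<epsilon> \<le> Z * Z" using Z mult_mono[of "real T" Z "1 / \<epsilon>" Z] eps by simp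
    moreover have "0 < real T / \<epsilon>" using T eps by simp
    ultimately have "ln (real T / \<epsilon>) \<le> Z ^ 2"
      using ln_le_minus_one[of "real T / \<epsilon>"] by (simp add: power2_eq_square)
    hence "max 1 (ln (real T / \<epsilon>)) \<le> Z ^ 2" using Zp(2)[of 2] by simp
    hence "sample_rate \<epsilon> T \<le> Z ^ 4 * Z ^ 2"
      unfolding sample_rate_def using eZ[of 4] eps by (intro mult_mono) auto
    also have "\<dots> = Z ^ 6" by (simp flip: power_add)
    finally have "C * sample_rate \<epsilon> T \<le> C * Z ^ 6" using C by (intro mult_left_mono) auto
    thus ?thesis using sample_size_le unfolding C_def by linarith
  qed
  have draws: "real draw_count \<le> q * Z ^ 7"
  proof -
    have "0 \<le> q * real T / \<epsilon> ^ 6" using C eps by simp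
    hence "real draw_count \<le> q * real T / \<epsilon> ^ 6" unfolding draws_of_def q_def by linarith
    also have "\<dots> = q * (real T * (1 / \<epsilon> ^ 6))" by simp
    also have "\<dots> \<le> q * (Z * Z ^ 6)"
      using C Z eZ[of 6] eps by (intro mult_left_mono mult_mono) auto
    also have "Z * Z ^ 6 = Z ^ 7" by (simp add: power_numeral_reduce)
    finally show ?thesis .
  qed
  have p: "real (predict_time n T B) \<le> (3 * real a + 17) * Z ^ (k + 1)"
  proof -
    have "2 * real B + 5 \<le> 2 * (real a * Z ^ k) + 5 * Z ^ k" using B Zp(2)[of k] by linarith
    hence "2 * real B + 5 \<le> (2 * real a + 5) * Z ^ k" by (simp add: algebra_simps)
    hence "real T * (2 * real B + 5) \<le> Z * ((2 * real a + 5) * Z ^ k)"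
      using Z by (intro mult_mono) auto
    also have "\<dots> = (2 * real a + 5) * Z ^ (k + 1)" by simp
    finally have 1: "real T * (2 * real B + 5) \<le> \<dots>" .
    have "real n \<le> Z ^ (k + 1)" using order_trans[OF Z(2)] Zp(1)[of 1 "k + 1"] by simp
    moreover have "real B \<le> real a * Z ^ (k + 1)" "1 \<le> Z ^ (k + 1)"
      using Zp(2)[of "k + 1"] order_trans[OF B mult_left_mono[OF Zp(1)[of k "k + 1"]]]
      by auto
    ultimately show ?thesis using 1 by (simp add: predict_time_def algebra_simps)
  qed
  define R where "R = 13 + C * (real a + 5) + q * (3 * real a + 17)"
  have R: "0 \<le> R" using C by (simp add: R_def)
  have refine: "real (refine_time n T ?M (draw_factor \<delta>) B \<epsilon>) \<le> R * Z ^ (k + 8)"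
  proof -
    have "real ?M * (real B + 5) \<le> (C * Z ^ 6) * ((real a + 5) * Z ^ k)"
      using M B5 C Z by (intro mult_mono) auto
    also have "\<dots> = C * (real a + 5) * Z ^ (k + 6)" by (simp add: power_add)
    also have "\<dots> \<le> C * (real a + 5) * Z ^ (k + 8)"
      using C Zp(1)[of "k + 6" "k + 8"] by (intro mult_left_mono) auto
    finally have 1: "real ?M * (real B + 5) \<le> \<dots>" .
    have "real draw_count * real (predict_time n T B) \<le> (q * Z ^ 7) * ((3 * real a + 17) * Z ^ (k + 1))"
      using draws p C Z by (intro mult_mono) auto
    also have "\<dots> = q * (3 * real a + 17) * Z ^ (k + 8)" by (simp add: power_add power_numeral_reduce)
    finally have 2: "real draw_count * real (predict_time n T B) \<le> \<dots>" .
    have "real (refine_time n T ?M (draw_factor \<delta>) B \<epsilon>) =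
        13 + real ?M * (real B + 5) + real draw_count * real (predict_time n T B)"
      by (simp add: refine_time_def)
    thus ?thesis using 1 2 Zp(2)[of "k + 8"] unfolding R_def distrib_right by linarith
  qed
  have "real ?L * real (refine_time n T ?M (draw_factor \<delta>) B \<epsilon>) \<le>
      (18 * Z ^ 2) * (R * Z ^ (k + 8))"
    using order_trans[OF rounds_le] eZ[of 2] refine R Z by (intro mult_mono) auto
  also have "\<dots> = 18 * R * Z ^ (k + 10)" by (simp add: power_add power_numeral_reduce)
  finally have "1 + real ?L * real (refine_time n T ?M (draw_factor \<delta>) B \<epsilon>) \<le>
      (1 + 18 * R) * Z ^ (k + 10)"
    using Zp(2)[of "k + 10"] unfolding distrib_right by linarith
  hence "real T * (1 + real ?L * real (refine_time n T ?M (draw_factor \<delta>) B \<epsilon>)) \<le>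
      Z * ((1 + 18 * R) * Z ^ (k + 10))"
    using Z by (intro mult_mono) auto
  also have "\<dots> = (1 + 18 * R) * Z ^ (k + 11)" by (simp add: power_add power_numeral_reduce)
  finally show ?thesis
    unfolding Z_def R_def C_def q_def B_def by (simp only: of_nat_mult of_nat_add of_nat_1)
qed

end

section \<open>Transfer from the abstract process to the machine\<close>

lemma dsq_run_rel:
  assumes sampler: "valid_sampler n X h th B" and n: "1 \<le> n" and f: "f \<in> X \<rightarrow> {- 1, 1}"
    and A: "valid_analyst X tq B A"
  shows "rel_pmf (\<lambda>(H, t) H'. H = H' \<and> t \<le> T * (1 + rounds_of \<epsilon> * refine_time n T M q B \<epsilon>))
    (dsq_run (oracle_prog q) n h th tq f \<epsilon> T M A)
    (replicate_pmf M (labeled_dist n h f) \<bind> (\<lambda>S. transcript (sampler_dist n h)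
       (draws_of T q \<epsilon>) (\<epsilon> / 4) (rounds_of \<epsilon>) A S T [] (\<lambda>_. 0, 0)))"
    (is "rel_pmf ?R _ _")
  unfolding dsq_run_def
\<comment> \<open>The samples are coupled by equality and confined to the support, which yields the
  assumptions of \<open>machine\<close> on them.\<close>
proof (rule rel_pmf_bindI[where R = "\<lambda>S S'. S = S' \<and> S \<in> set_pmf (replicate_pmf M (labeled_dist n h f))"])
  show "rel_pmf (\<lambda>S S'. S = S' \<and> S \<in> set_pmf (replicate_pmf M (labeled_dist n h f)))
      (replicate_pmf M (labeled_dist n h f)) (replicate_pmf M (labeled_dist n h f))"
    by (rule rel_pmf_reflI) simp
next
  fix S S' assume "S = S' \<and> S \<in> set_pmf (replicate_pmf M (labeled_dist n h f))"
  hence [simp]: "S' = S" and S: "length S = M" "set S \<subseteq> set_pmf (labeled_dist n h f)"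
    by (auto simp: set_replicate_pmf)
  have "h r \<in> X" if "r \<in> set_pmf (pmf_of_set {r. length r = n - 1})" for r
    using that sampler unfolding replicate_pmf_coin[symmetric]
    by (auto simp: valid_sampler_def set_replicate_pmf)
  hence "set_pmf (labeled_dist n h f) \<subseteq> X \<times> {- 1, 1}"
    using f by (auto simp: labeled_dist_def sampler_dist_def)
  then interpret machine n T M q B \<epsilon> X h th tq S
    using sampler n S by unfold_locales auto
  have "rel_pmf (\<lambda>(H', s') H''. H' = H'' \<and> clock s' \<le>
        clock (init_state n T M \<epsilon> :: 'a state) + T * (1 + rounds * refine_cost))
      (interact (oracle_prog q) (env_of []) A T [] (init_state n T M \<epsilon>))
      (transcript D draws (\<epsilon> / 4) rounds A S T [] (\<lambda>_. 0, 0))"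
    by (rule interact_oracle_prog[OF A])
       (auto simp: inputs_def init_state_def represents_def hypothesis_def)
  hence *: "rel_pmf (\<lambda>(H', s') H''. H' = H'' \<and> clock s' \<le> T * (1 + rounds * refine_cost))
      (interact (oracle_prog q) (env_of []) A T [] (init_state n T M \<epsilon>))
      (transcript D draws (\<epsilon> / 4) rounds A S T [] (\<lambda>_. 0, 0))"
    by (simp add: init_state_def)
  have "rel_pmf ?R (interact (oracle_prog q) (env_of []) A T [] (init_state n T M \<epsilon>) \<bind>
        (\<lambda>(H, s). return_pmf (H, clock s)))
      (transcript D draws (\<epsilon> / 4) rounds A S T [] (\<lambda>_. 0, 0) \<bind> return_pmf)"
    by (rule rel_pmf_bindI[OF *]) auto
  thus "rel_pmf ?R
     (interact (oracle_prog q)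
        \<lparr>bits = n - 1, sampler = h, hcost = th, qcost = tq, samples = S, queries = []\<rparr>
        A T [] (init_state n T M \<epsilon>) \<bind> (\<lambda>(H, s). return_pmf (H, clock s)))
     (transcript D draws (\<epsilon> / 4) rounds A S' T [] (\<lambda>_. 0, 0))"
    by (simp add: bind_return_pmf' env_of_def)
qed

text \<open>Takes \<open>\<eta> = \<epsilon> / 4\<close> and gets both deviation bounds from
  Hoeffding's inequality, with range \<open>1\<close> for queries and \<open>1 + K * \<eta>\<close>
  for predictions. Samples and fresh points receive \<open>\<delta> / 2\<close> each.\<close>

lemma transcript_failure_le:
  assumes sampler: "valid_sampler n X h th B" and f: "f \<in> X \<rightarrow> {- 1, 1}"
    and A: "valid_analyst X tq B A"
    and eps: "0 < \<epsilon>" "\<epsilon> < 1" and T: "1 \<le> T" and del: "0 < \<delta>" "\<delta> < 1"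
  shows "measure_pmf.prob
     (replicate_pmf (sample_size \<delta> \<epsilon> T) (labeled_dist n h f) \<bind> (\<lambda>S. transcript (sampler_dist n h)
       (draws_of T (draw_factor \<delta>) \<epsilon>) (\<epsilon> / 4) (rounds_of \<epsilon>) A S T [] (\<lambda>_. 0, 0)))
     {H. \<not> dsq_correct (labeled_dist n h f) \<epsilon> H} \<le> \<delta>"
proof -
  let ?D = "sampler_dist n h" and ?K = "budget \<epsilon>"
  let ?m = "draws_of T (draw_factor \<delta>) \<epsilon>" and ?M = "sample_size \<delta> \<epsilon> T"
  define bS where "bS = 2 * exp (- (real ?M * (\<epsilon> / 4)\<^sup>2 / (2 * 1\<^sup>2)))"
  define bh where "bh = 2 * exp (- (real ?m * (\<epsilon> / 4)\<^sup>2 / (2 * (1 + real ?K * (\<epsilon> / 4))\<^sup>2)))"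
  have supp: "set_pmf ?D = h ` {r. length r = n - 1}"
    by (auto simp: sampler_dist_def set_replicate_pmf simp flip: replicate_pmf_coin)
  have DX: "set_pmf ?D \<subseteq> X" using sampler by (auto simp: supp valid_sampler_def)
  interpret U: unknown_labels ?D f "\<epsilon> / 4"
  proof
    show "finite (set_pmf ?D)"
      unfolding supp using finite_lists_length_eq[of "UNIV :: bool set" "n - 1"] by simp
  qed (use DX f eps in auto)
  have DF: "U.DF = labeled_dist n h f" by (simp add: U.DF_def labeled_dist_def)
  interpret oracle_run ?D f "\<epsilon> / 4" ?m ?M ?K "rounds_of \<epsilon>" bS bh
  proof
    show "?K < rounds_of \<epsilon>" by (rule budget_less_rounds) fact+
    have "16 / \<epsilon>\<^sup>2 \<le> real ?K" by (rule budget_ge[OF eps T del])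
    thus "1 \<le> real ?K * (\<epsilon> / 4)\<^sup>2" using eps by (simp add: field_simps)
    show "0 \<le> bS" "0 \<le> bh" by (simp_all add: bS_def bh_def)
  next
    fix \<phi> :: "'a query" assume \<phi>: "U.bounded_query \<phi>"
    have "\<bar>\<phi> z\<bar> \<le> 1" if z: "z \<in> set_pmf U.DF" for z
    proof -
      obtain x where x: "x \<in> set_pmf ?D" "z = (x, f x)" using z by (auto simp: U.DF_def)
      with U.lab[OF x(1)] \<phi> show ?thesis by (auto simp: U.bounded_query_def)
    qed
    thus "measure_pmf.prob (replicate_pmf ?M U.DF) {S. \<epsilon> / 4 < \<bar>mean \<phi> S - U.value_of \<phi>\<bar>} \<le> bS"
      unfolding bS_def using eps sample_size_pos[OF eps T del] by (intro Hoeffding_replicate_pmf) auto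
  next
    fix \<phi> :: "'a query" and g :: "'a \<Rightarrow> real"
    assume \<phi>: "U.bounded_query \<phi>" and g: "\<And>x. x \<in> set_pmf ?D \<Longrightarrow> \<bar>g x\<bar> \<le> real ?K * (\<epsilon> / 4)"
    show "measure_pmf.prob (replicate_pmf ?m ?D)
        {w. \<epsilon> / 4 < \<bar>mean (predict \<phi> g) w - U.expt (predict \<phi> g)\<bar>} \<le> bh"
      unfolding bh_def
    proof (rule Hoeffding_replicate_pmf)
      show "0 < 1 + real ?K * (\<epsilon> / 4)" using eps by (simp add: add_pos_nonneg)
    qed (use eps draws_pos[OF eps T del] U.predict_le[OF \<phi>] g in auto)
  qed
  have "U.bounded_query \<phi>" if "\<phi> \<in> set_pmf (A H)" for \<phi> H
  proof -
    have "valid_query X tq B \<phi>" using A that by (auto simp: valid_analyst_def)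
    thus ?thesis using DX by (fastforce simp: U.bounded_query_def valid_query_def abs_le_iff)
  qed
  from transcript_correct[where A = A and T = T and v = 0, OF this]
  have "measure_pmf.prob (replicate_pmf ?M (labeled_dist n h f) \<bind> (\<lambda>S. transcript ?D ?m (\<epsilon> / 4)
      (rounds_of \<epsilon>) A S T [] (\<lambda>_. 0, 0))) {H. \<not> dsq_correct (labeled_dist n h f) \<epsilon> H}
    \<le> real (T * rounds_of \<epsilon>) * bh + bS * real (leaves (T * rounds_of \<epsilon>) ?K)"
    by (simp add: DF)
  also have "\<dots> \<le> \<delta> / 2 + \<delta> / 2"
    unfolding bS_def bh_def
    by (intro add_mono estimate_failure_le sample_failure_le eps T del)
  finally show ?thesis by simp
qed

text \<open>Program, sample size and constant are chosen from \<open>\<delta>\<close> alone;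
  \<open>a\<close> and \<open>k\<close> affect only the polynomial. The coupling maps bad runs to
  bad transcripts of no smaller probability, and its time bound holds on the whole support.\<close>

theorem theorem7:
  fixes \<delta> :: real
  assumes "0 < \<delta>" and "\<delta> < 1"
  shows "\<exists>(P :: prog) (M :: real \<Rightarrow> nat \<Rightarrow> nat) (C :: real).
    (\<forall>\<epsilon> T. 0 < \<epsilon> \<and> \<epsilon> < 1 \<and> 1 \<le> T \<longrightarrow> real (M \<epsilon> T) \<le> C * sample_rate \<epsilon> T) \<and>
    (\<forall>a k :: nat. \<exists>b l :: nat.
      \<forall>n (X :: 'x set) h th f \<epsilon> T tq A.
        1 \<le> n \<and> finite X \<and> valid_sampler n X h th (a * n ^ k) \<and> f \<in> X \<rightarrow> {-1, 1} \<and>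
        0 < \<epsilon> \<and> \<epsilon> < 1 \<and> 1 \<le> T \<and> valid_analyst X tq (a * n ^ k) A \<longrightarrow>
        measure_pmf.prob (dsq_run P n h th tq f \<epsilon> T (M \<epsilon> T) A)
          {(H, t). dsq_correct (labeled_dist n h f) \<epsilon> H} \<ge> 1 - \<delta> \<and>
        (\<forall>(H, t) \<in> set_pmf (dsq_run P n h th tq f \<epsilon> T (M \<epsilon> T) A).
          real t \<le> real b * (real n + 1 / \<epsilon> + real T) ^ l))"
proof (intro exI conjI allI impI)
  fix \<epsilon> :: real and T :: nat assume "0 < \<epsilon> \<and> \<epsilon> < 1 \<and> 1 \<le> T"
  thus "real (sample_size \<delta> \<epsilon> T) \<le> size_const \<delta> * sample_rate \<epsilon> T"
    using assms by (intro sample_size_le) auto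
next
  fix a k n :: nat and X :: "'x set" and h th and f :: "'x \<Rightarrow> int" and \<epsilon> :: real and T :: nat and tq A
  assume asm: "1 \<le> n \<and> finite X \<and> valid_sampler n X h th (a * n ^ k) \<and> f \<in> X \<rightarrow> {-1, 1} \<and>
        0 < \<epsilon> \<and> \<epsilon> < 1 \<and> 1 \<le> T \<and> valid_analyst X tq (a * n ^ k) A"
  define run where "run = dsq_run (oracle_prog (draw_factor \<delta>)) n h th tq f \<epsilon> T (sample_size \<delta> \<epsilon> T) A"
  define cost where "cost = T * (1 + rounds_of \<epsilon> *
    refine_time n T (sample_size \<delta> \<epsilon> T) (draw_factor \<delta>) (a * n ^ k) \<epsilon>)"
  let ?tr = "replicate_pmf (sample_size \<delta> \<epsilon> T) (labeled_dist n h f) \<bind> (\<lambda>S. transcript (sampler_dist n h)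
       (draws_of T (draw_factor \<delta>) \<epsilon>) (\<epsilon> / 4) (rounds_of \<epsilon>) A S T [] (\<lambda>_. 0, 0))"
  let ?R = "\<lambda>(H :: 'x history, t :: nat) H'. H = H' \<and> t \<le> cost"
  have rel: "rel_pmf ?R run ?tr"
    unfolding run_def cost_def using asm by (intro dsq_run_rel) auto
  let ?good = "{(H, t :: nat). dsq_correct (labeled_dist n h f) \<epsilon> H}"
  have "measure_pmf.prob run (- ?good) \<le> measure_pmf.prob ?tr {H'. \<exists>x\<in>- ?good. ?R x H'}"
    by (rule rel_pmf_measureD[OF rel])
  also have "\<dots> \<le> measure_pmf.prob ?tr {H. \<not> dsq_correct (labeled_dist n h f) \<epsilon> H}"
    by (rule measure_pmf.finite_measure_mono) auto
  also have "\<dots> \<le> \<delta>"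
    using asm assms by (intro transcript_failure_le) auto
  finally show "1 - \<delta> \<le> measure_pmf.prob run ?good"
    using measure_pmf.prob_compl[of ?good run] by (simp add: Compl_eq_Diff_UNIV)
  define c where "c = 1 + 18 * (13 + size_const \<delta> * (real a + 5) + real (draw_factor \<delta>) * (3 * real a + 17))"
  show "\<forall>(H, t) \<in> set_pmf run. real t \<le> real (nat \<lceil>c\<rceil>) * (real n + 1 / \<epsilon> + real T) ^ (k + 11)"
  proof (intro ballI, clarify)
    fix H t assume "(H, t) \<in> set_pmf run"
    hence "t \<le> cost" using rel_pmf_imp_rel_set[OF rel] by (fastforce simp: rel_set_def)
    hence "real t \<le> real cost" by simp
    also have "\<dots> \<le> c * (real n + 1 / \<epsilon> + real T) ^ (k + 11)"
      unfolding cost_def c_def using asm assms by (intro runtime_le) auto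
    also have "\<dots> \<le> real (nat \<lceil>c\<rceil>) * (real n + 1 / \<epsilon> + real T) ^ (k + 11)"
      using asm by (intro mult_right_mono real_nat_ceiling_ge) auto
    finally show "real t \<le> real (nat \<lceil>c\<rceil>) * (real n + 1 / \<epsilon> + real T) ^ (k + 11)" .
  qed
qed

end
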